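(* For every integer $n\ge 2$, the quantity $\lambda_n$ defined in the context satisfies $$\frac{n}{2\log_2 n}\;\le\;\lambda_n\;<\;2^{2^n}.$$
   Context: Let $N$ be a finite set with $n=|N|\ge 2$ elements. Elements of $N$ are identified with singletons, and $aA$ denotes $A\cup\{a\}$; thus $f(a)$ means $f(\{a\})$. A polymatroid on $N$ is a function $f$ assigning a real number to each subset of $N$ that is pointed ($f(\emptyset)=0$), monotone ($A\subseteq B\subseteq N$ implies $f(A)\le f(B)$) and submodular ($f(A)+f(B)\ge f(A\cap B)+f(A\cup B)$ for all $A,B\subseteq N$). Fix $a\in N$. A polymatroid $h$ on $N$ does not depend on $a$ if $h(aA)=h(A)$ for all $A\subseteq N\setminus\{a\}$. A polymatroid $f$ on $N$ is $a$-reduced if for any decomposition $f=g+h$ into the sum of two polymatroids on $N$ such that $h$ does not depend on $a$, it follows that $h$ is identically zero. For a polymatroid $f$ on $N$ with $f(a)>0$ put $C_{f,a}=\max_{b\in N} f(b)/f(a)$. Define $$\lambda_n=\sup\{C_{f,a}: f \text{ is an } a\text{-reduced polymatroid on } N \text{ with } f(a)>0\},$$ where $|N|=n$ (by symmetry the value depends only on $n$, not on the choice of $N$ and $a\in N$). *)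

theory Defs
  imports Complex_Main "HOL-Library.Extended_Real"
begin

text \<open>
  A set function on \<open>N\<close> is a total function on \<open>'a set\<close> of which only the values
  at subsets of \<open>N\<close> are relevant.
\<close>

definition polymatroid :: "'a set \<Rightarrow> ('a set \<Rightarrow> real) \<Rightarrow> bool" where
  "polymatroid N f \<longleftrightarrow>
     f {} = 0 \<and>
     (\<forall>A B. A \<subseteq> B \<and> B \<subseteq> N \<longrightarrow> f A \<le> f B) \<and>
     (\<forall>A B. A \<subseteq> N \<and> B \<subseteq> N \<longrightarrow> f A + f B \<ge> f (A \<inter> B) + f (A \<union> B))"

definition not_depends_on :: "'a set \<Rightarrow> 'a \<Rightarrow> ('a set \<Rightarrow> real) \<Rightarrow> bool" where
  "not_depends_on N a h \<longleftrightarrow> (\<forall>A. A \<subseteq> N - {a} \<longrightarrow> h (insert a A) = h A)"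

definition reduced_polymatroid :: "'a set \<Rightarrow> 'a \<Rightarrow> ('a set \<Rightarrow> real) \<Rightarrow> bool" where
  "reduced_polymatroid N a f \<longleftrightarrow>
     polymatroid N f \<and>
     (\<forall>g h. polymatroid N g \<and> polymatroid N h \<and> (\<forall>A. A \<subseteq> N \<longrightarrow> f A = g A + h A) \<and>
            not_depends_on N a h
        \<longrightarrow> (\<forall>A. A \<subseteq> N \<longrightarrow> h A = 0))"

definition singleton_ratio :: "'a set \<Rightarrow> 'a \<Rightarrow> ('a set \<Rightarrow> real) \<Rightarrow> real" where
  "singleton_ratio N a f = Max ((\<lambda>b. f {b} / f {a}) ` N)"

text \<open>
  The supremum is taken in the extended reals, so that an upper bound on it
  includes the claim that the set of ratios is bounded.
  For finite \<open>N\<close> and \<open>a \<in> N\<close>, the value depends on \<open>card N\<close> only.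
\<close>

definition reduced_sup :: "'a set \<Rightarrow> 'a \<Rightarrow> ereal" where
  "reduced_sup N a =
     (SUP f \<in> {f. reduced_polymatroid N a f \<and> f {a} > 0}. ereal (singleton_ratio N a f))"

end

theory Submission
  imports Defs "HOL-Library.FuncSet" "HOL-Analysis.Convex"
begin

text \<open>
  Write \<open>M = N - {a}\<close>, so that \<open>M\<close> has \<open>m = n - 1\<close> elements, and call \<open>f(aK) - f(K)\<close> the marginal
  of \<open>a\<close> at \<open>K \<subseteq> M\<close>. A polymatroid \<open>h\<close> that does not depend on \<open>a\<close> is a polymatroid on \<open>M\<close>, and
  subtracting it from \<open>f\<close> does not change the marginals of \<open>a\<close>. On both sides of the theorem the
  polymatroids are handled through the finitely many elementary inequalities that define them:
  \<open>f(iK) + f(jK) \<ge> f(K) + f(ijK)\<close> and \<open>f(N) \<ge> f(N - i)\<close>. The difference of the two sides of the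
  first of these is called a gap.

  Upper bound. A small multiple of \<open>h\<close> can be subtracted from \<open>f\<close> unless some elementary inequality
  is tight for \<open>f\<close> and strict for \<open>h\<close>. First, an \<open>a\<close>-reduced \<open>f\<close> satisfies \<open>f(N) = f(N - i)\<close> for
  \<open>i \<in> M\<close> (\<open>reduced_tight\<close>), since otherwise a multiple of the modular function \<open>[i \<in> A]\<close> could be
  subtracted. Call a triple \<open>(i, j, K)\<close> in \<open>M\<close> dead if the gap of \<open>f\<close> vanishes at \<open>K\<close> or at \<open>aK\<close>. Then
  the zero function is the only polymatroid \<open>h\<close> on \<open>M\<close> with \<open>h(M) = h(M - i)\<close> for all \<open>i\<close> whose gap
  vanishes at all dead triples. In other words, the polyhedron of functions on \<open>M\<close> vanishing at the
  empty set, with these equations, all gaps nonnegative, and gaps at most 1 at the dead triples, has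
  no directions of recession. The marginals of \<open>a\<close> decrease with the set and lie between 0 and \<open>f(a)\<close>,
  whence a dead gap of \<open>f\<close> at \<open>K\<close> is at most \<open>f(a)\<close> (\<open>gap_le_if_dead\<close>); so \<open>f/f(a)\<close> restricted to \<open>M\<close>, made tight by subtracting a modular function
  with values at most 1 at the singletons, is a point of this polyhedron. It remains to bound the
  coordinates of its points in terms of the dimension \<open>d \<le> 2^m - 1 - m\<close> only. A coordinate is maximal at
  a vertex, a vertex is determined by at most \<open>d\<close> tight constraints, each with four coefficients
  \<open>\<plusminus>1\<close> and constant term 0 or 1, and by the pigeonhole principle (Siegel's lemma) such a system has a
  small integral projective solution, which must represent the vertex
  (\<open>bounded_polyhedron_coordinate_bound\<close>). The resulting bound \<open>2 d 4^d\<close> is less than \<open>2^(2^n)\<close>.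

  Lower bound. This is Csirmaz's construction from secret sharing. For every upward closed family of
  qualified subsets of \<open>M\<close> some polymatroid has marginals of \<open>a\<close> equal to 0 at the qualified sets and 1
  at the others (\<open>polymatroid_with_marginals\<close>). Repeatedly subtracting polymatroids not depending on
  \<open>a\<close>, until nothing can be subtracted, makes it \<open>a\<close>-reduced without changing the marginals
  (\<open>exists_reduced_part\<close>). For a suitable family (\<open>chain_qualified\<close>) the marginals alone force a set of \<open>k\<close>
  elements to have rank at least \<open>min (2^k - 1) (n - k)\<close> times \<open>f(a)\<close> (\<open>chain_lower_bound\<close>), so that one of
  its elements has at least a \<open>k\<close>-th part of this. Taking \<open>k = \<lfloor>log\<^sub>2 n\<rfloor>\<close> gives the bound; the
  factor 2 pays for the integers \<open>n\<close> between consecutive powers of 2.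
\<close>

section \<open>Elementary inequalities of polymatroids\<close>

definition gap :: "('a set \<Rightarrow> real) \<Rightarrow> 'a \<Rightarrow> 'a \<Rightarrow> 'a set \<Rightarrow> real" where
  "gap f i j K = f (insert i K) + f (insert j K) - f K - f (insert i (insert j K))"

definition elementary_forms :: "'a set \<Rightarrow> (('a set \<Rightarrow> real) \<Rightarrow> real) set" where
  "elementary_forms N = {\<lambda>f. gap f i j K | i j K. i \<in> N \<and> j \<in> N \<and> i \<noteq> j \<and> K \<subseteq> N - {i, j}} \<union>
     {\<lambda>f. f N - f (N - {i}) | i. i \<in> N}"

lemma gap_commute: "gap f i j K = gap f j i K"
  by (simp add: gap_def insert_commute)

lemma marginal_antimono:
  assumes fin: "finite N"
    and gaps: "\<And>i j K. i \<in> N \<Longrightarrow> j \<in> N \<Longrightarrow> i \<noteq> j \<Longrightarrow> K \<subseteq> N - {i, j} \<Longrightarrow> gap f i j K \<ge> 0"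
    and "A \<subseteq> B" "B \<subseteq> N" "x \<in> N" "x \<notin> B"
  shows "f (insert x B) - f B \<le> f (insert x A) - f A"
proof -
  have "finite (B - A)" using fin assms(4) by (meson finite_Diff finite_subset)
  moreover have "f (insert x (A \<union> C)) - f (A \<union> C) \<le> f (insert x A) - f A"
    if "finite C" "C \<subseteq> B - A" for C
    using that
  proof (induction C rule: finite_induct)
    case (insert y C)
    have "gap f x y (A \<union> C) \<ge> 0"
      by (rule gaps) (use insert.prems insert.hyps assms in auto)
    then show ?case using insert unfolding gap_def by simp
  qed simp
  ultimately have "f (insert x (A \<union> (B - A))) - f (A \<union> (B - A)) \<le> f (insert x A) - f A" by blast
  then show ?thesis using assms(3) by (simp add: Un_absorb1)
qed

text \<open>
  Submodularity amounts to marginals decreasing with the set, which needs only to be checked when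
  one element is added. Then the smallest marginal of \<open>i\<close> is the one at \<open>N - {i}\<close>, so monotonicity
  needs only to be checked there.
\<close>

lemma polymatroidI:
  assumes fin: "finite N" and zero: "f {} = 0"
    and gaps: "\<And>i j K. i \<in> N \<Longrightarrow> j \<in> N \<Longrightarrow> i \<noteq> j \<Longrightarrow> K \<subseteq> N - {i, j} \<Longrightarrow> gap f i j K \<ge> 0"
    and top: "\<And>i. i \<in> N \<Longrightarrow> f (N - {i}) \<le> f N"
  shows "polymatroid N f"
  unfolding polymatroid_def
proof (intro conjI allI impI)
  note anti = marginal_antimono[of N f, OF fin gaps]
  show "f {} = 0" by (rule zero)
  fix A B :: "'a set"
  {
    assume AB: "A \<subseteq> B \<and> B \<subseteq> N"
    have "finite (B - A)" using fin AB by (meson finite_Diff finite_subset)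
    moreover have "f A \<le> f (A \<union> C)" if "finite C" "C \<subseteq> B - A" for C
      using that
    proof (induction C rule: finite_induct)
      case (insert y C)
      have "f (insert y (N - {y})) - f (N - {y}) \<le> f (insert y (A \<union> C)) - f (A \<union> C)"
        by (rule anti) (use insert.prems insert.hyps AB in auto)
      moreover have "insert y (N - {y}) = N" using insert.prems AB by auto
      moreover have "f (N - {y}) \<le> f N" using top insert.prems AB by auto
      ultimately show ?case using insert by simp
    qed simp
    ultimately have "f A \<le> f (A \<union> (B - A))" by blast
    then show "f A \<le> f B" using AB by (simp add: Un_absorb1)
  next
    assume AB: "A \<subseteq> N \<and> B \<subseteq> N"
    have "finite (A - B)" using fin AB by (meson finite_Diff finite_subset)
    moreover have "f (B \<union> C) - f B \<le> f ((A \<inter> B) \<union> C) - f (A \<inter> B)"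
      if "finite C" "C \<subseteq> A - B" for C
      using that
    proof (induction C rule: finite_induct)
      case (insert y C)
      have "f (insert y (B \<union> C)) - f (B \<union> C)
          \<le> f (insert y ((A \<inter> B) \<union> C)) - f ((A \<inter> B) \<union> C)"
        by (rule anti) (use insert.prems insert.hyps AB in auto)
      then show ?case using insert by simp
    qed simp
    ultimately have "f (B \<union> (A - B)) - f B \<le> f ((A \<inter> B) \<union> (A - B)) - f (A \<inter> B)" by blast
    moreover have "B \<union> (A - B) = A \<union> B" "(A \<inter> B) \<union> (A - B) = A" by auto
    ultimately show "f (A \<inter> B) + f (A \<union> B) \<le> f A + f B" by simp
  }
qed

lemma polymatroid_mono: "polymatroid N f \<Longrightarrow> A \<subseteq> B \<Longrightarrow> B \<subseteq> N \<Longrightarrow> f A \<le> f B"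
  unfolding polymatroid_def by blast

lemma polymatroid_submod:
  "polymatroid N f \<Longrightarrow> A \<subseteq> N \<Longrightarrow> B \<subseteq> N \<Longrightarrow> f (A \<inter> B) + f (A \<union> B) \<le> f A + f B"
  unfolding polymatroid_def by blast

lemma polymatroid_gap:
  assumes "polymatroid N f" "i \<in> N" "j \<in> N" "i \<noteq> j" "K \<subseteq> N - {i, j}"
  shows "gap f i j K \<ge> 0"
proof -
  have "insert i K \<inter> insert j K = K" "insert i K \<union> insert j K = insert i (insert j K)"
    "insert i K \<subseteq> N" "insert j K \<subseteq> N"
    using assms by auto
  then show ?thesis
    using polymatroid_submod[OF assms(1), of "insert i K" "insert j K"] unfolding gap_def by simp
qed

lemma polymatroid_iff_forms:
  assumes "finite N"
  shows "polymatroid N f \<longleftrightarrow> f {} = 0 \<and> (\<forall>\<phi>\<in>elementary_forms N. \<phi> f \<ge> 0)"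
proof
  assume p: "polymatroid N f"
  then show "f {} = 0 \<and> (\<forall>\<phi>\<in>elementary_forms N. \<phi> f \<ge> 0)"
    using polymatroid_gap[OF p] polymatroid_mono[OF p]
    by (auto simp: elementary_forms_def polymatroid_def)
next
  assume f: "f {} = 0 \<and> (\<forall>\<phi>\<in>elementary_forms N. \<phi> f \<ge> 0)"
  show "polymatroid N f"
  proof (rule polymatroidI[OF assms])
    show "f {} = 0" using f by simp
  next
    fix i j K assume "i \<in> N" "j \<in> N" "i \<noteq> j" "K \<subseteq> N - {i, j}"
    then have "(\<lambda>f. gap f i j K) \<in> elementary_forms N" by (auto simp: elementary_forms_def)
    then show "gap f i j K \<ge> 0" using f by fastforce
  next
    fix i assume "i \<in> N"
    then have "(\<lambda>f. f N - f (N - {i})) \<in> elementary_forms N" by (auto simp: elementary_forms_def)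
    then show "f (N - {i}) \<le> f N" using f by fastforce
  qed
qed

lemma gap_linear: "gap (\<lambda>A. f A - t * h A) i j K = gap f i j K - t * gap h i j K"
  by (simp add: gap_def algebra_simps)

lemma elementary_forms_linear:
  "\<phi> \<in> elementary_forms N \<Longrightarrow> \<phi> (\<lambda>A. f A - t * h A) = \<phi> f - t * \<phi> h"
  by (auto simp: elementary_forms_def gap_linear algebra_simps)

lemma elementary_forms_cong:
  assumes "\<phi> \<in> elementary_forms N" "\<And>A. A \<subseteq> N \<Longrightarrow> f A = g A"
  shows "\<phi> f = \<phi> g"
proof -
  consider i j K where "\<phi> = (\<lambda>f. gap f i j K)" "i \<in> N" "j \<in> N" "K \<subseteq> N - {i, j}"
    | i where "\<phi> = (\<lambda>f. f N - f (N - {i}))"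
    using assms(1) unfolding elementary_forms_def by blast
  then show ?thesis
  proof cases
    case 1
    then have "K \<subseteq> N" "insert i K \<subseteq> N" "insert j K \<subseteq> N" "insert i (insert j K) \<subseteq> N" by auto
    then show ?thesis using 1(1) assms(2) by (simp add: gap_def)
  next
    case 2
    have "N - {i} \<subseteq> N" by blast
    then show ?thesis using 2 assms(2) by simp
  qed
qed

lemma finite_elementary_forms: assumes "finite N" shows "finite (elementary_forms N)"
proof -
  have "elementary_forms N \<subseteq> (\<lambda>(i, j, K) f. gap f i j K) ` (N \<times> N \<times> Pow N) \<union> (\<lambda>i f. f N - f (N - {i})) ` N"
  proof
    fix \<phi> assume "\<phi> \<in> elementary_forms N"
    then consider i j K where "\<phi> = (\<lambda>f. gap f i j K)" "i \<in> N" "j \<in> N" "K \<subseteq> N"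
      | i where "\<phi> = (\<lambda>f. f N - f (N - {i}))" "i \<in> N"
      unfolding elementary_forms_def by blast
    then show "\<phi> \<in> (\<lambda>(i, j, K) f. gap f i j K) ` (N \<times> N \<times> Pow N) \<union> (\<lambda>i f. f N - f (N - {i})) ` N"
    proof cases
      case 1
      then have "(i, j, K) \<in> N \<times> N \<times> Pow N" by simp
      from imageI[OF this, of "\<lambda>(i, j, K) f. gap f i j K"] show ?thesis using 1(1) by simp
    qed simp
  qed
  then show ?thesis using assms by (simp add: finite_subset)
qed

section \<open>Splitting off polymatroids that do not depend on an element\<close>

text \<open>
  The ratio test of the simplex method: the largest multiple of \<open>q\<close> that can be subtracted from \<open>p\<close> is
  \<open>min p/q\<close> over the entries with \<open>q > 0\<close>, and it makes the minimizing entry tight.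
\<close>

lemma ratio_test:
  fixes p q :: "'b \<Rightarrow> real"
  assumes "finite C" "\<And>c. c \<in> C \<Longrightarrow> p c \<ge> 0" "\<exists>c\<in>C. q c > 0"
  shows "\<exists>t\<ge>0. (\<forall>c\<in>C. p c - t * q c \<ge> 0) \<and> (\<exists>c\<in>C. q c > 0 \<and> p c - t * q c = 0)"
proof -
  let ?P = "{c \<in> C. q c > 0}" and ?r = "\<lambda>c. p c / q c"
  have P: "finite ?P" "?P \<noteq> {}" using assms by auto
  obtain c where c: "c \<in> ?P" "\<And>x. x \<in> ?P \<Longrightarrow> ?r c \<le> ?r x"
    using P arg_min_if_finite(1)[of ?P ?r] arg_min_least[of ?P _ ?r] by blast
  have "p x - ?r c * q x \<ge> 0" if "x \<in> C" for x
  proof (cases "q x > 0")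
    case True
    then have "?r c \<le> ?r x" using c(2) that by blast
    then show ?thesis using True by (simp add: pos_le_divide_eq)
  next
    case False
    have "?r c \<ge> 0" using c assms(2) by simp
    then have "?r c * q x \<le> 0" using False by (intro mult_nonneg_nonpos) auto
    then show ?thesis using assms(2)[OF that] by linarith
  qed
  moreover have "?r c \<ge> 0" "p c - ?r c * q c = 0" using c assms(2) by auto
  ultimately show ?thesis using c(1) by blast
qed

lemma small_step:
  fixes p q :: "'b \<Rightarrow> real"
  assumes "finite C" "\<And>c. c \<in> C \<Longrightarrow> p c \<ge> 0" "\<And>c. c \<in> C \<Longrightarrow> q c > 0 \<Longrightarrow> p c > 0"
  shows "\<exists>t>0. \<forall>c\<in>C. p c - t * q c \<ge> 0"
proof (cases "\<exists>c\<in>C. q c > 0")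
  case True
  then obtain t where t: "t \<ge> 0" "\<forall>c\<in>C. p c - t * q c \<ge> 0"
    "\<exists>c\<in>C. q c > 0 \<and> p c - t * q c = 0"
    using ratio_test[of C p q] assms by blast
  then have "t \<noteq> 0" using assms(3) by force
  then show ?thesis using t by (intro exI[of _ t]) auto
next
  case False
  have "p c - 1 * q c \<ge> 0" if "c \<in> C" for c
    using that False assms(2)[OF that] by force
  then show ?thesis by (intro exI[of _ 1]) simp
qed

text \<open>
  If all elementary forms vanish at \<open>h\<close>, then \<open>-h\<close> is a polymatroid as well, and both are
  nonnegative.
\<close>

lemma nonzero_polymatroid_positive_form:
  assumes fin: "finite N" and h: "polymatroid N h" and "A \<subseteq> N" "h A \<noteq> 0"
  shows "\<exists>\<phi>\<in>elementary_forms N. \<phi> h > 0"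
proof (rule ccontr)
  assume neg: "\<not> ?thesis"
  define h' where "h' = (\<lambda>A. h A - 2 * h A)"
  have "\<phi> h' \<ge> 0" if "\<phi> \<in> elementary_forms N" for \<phi>
    using elementary_forms_linear[OF that, of h 2 h] neg that unfolding h'_def by fastforce
  moreover have "h {} = 0" using h by (simp add: polymatroid_def)
  ultimately have "polymatroid N h'"
    using polymatroid_iff_forms[OF fin] by (simp add: h'_def)
  from polymatroid_mono[OF this, of "{}" A] polymatroid_mono[OF h, of "{}" A]
  show False using assms(3,4) \<open>h {} = 0\<close> by (simp add: h'_def)
qed

text \<open>
  If \<open>f = g + h\<close> with \<open>h \<noteq> 0\<close> not depending on \<open>a\<close>, subtract from \<open>f\<close> the largest possible multiple of \<open>h\<close>.
  The forms vanishing at \<open>f\<close> vanish at \<open>h\<close> too, since they are nonnegative at both \<open>g\<close> and \<open>h\<close>, so they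
  still vanish after the subtraction, and at least one more form does. Hence the process ends.
\<close>

lemma exists_reduced_part:
  assumes fin: "finite N" and "polymatroid N f"
  shows "\<exists>g. reduced_polymatroid N a g \<and>
    (\<forall>A. A \<subseteq> N - {a} \<longrightarrow> g (insert a A) - g A = f (insert a A) - f A)"
  using assms(2)
proof (induction "card {\<phi> \<in> elementary_forms N. \<phi> f \<noteq> 0}" arbitrary: f rule: less_induct)
  case less
  show ?case
  proof (cases "reduced_polymatroid N a f")
    case False
    then obtain g h where gh: "polymatroid N g" "polymatroid N h" "not_depends_on N a h"
        "\<And>A. A \<subseteq> N \<Longrightarrow> f A = g A + h A" and nz: "\<exists>A. A \<subseteq> N \<and> h A \<noteq> 0"
      using less.prems unfolding reduced_polymatroid_def by blast
    have split: "\<phi> f = \<phi> g + \<phi> h" if "\<phi> \<in> elementary_forms N" for \<phi>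
      using elementary_forms_cong[OF that, of f "\<lambda>A. g A - (- 1) * h A"] gh(4)
        elementary_forms_linear[OF that, of g "- 1" h] by simp
    note poly = polymatroid_iff_forms[OF fin]
    have pos: "\<phi> f \<ge> 0" "\<phi> g \<ge> 0" "\<phi> h \<ge> 0" if "\<phi> \<in> elementary_forms N" for \<phi>
      using that less.prems gh poly by blast+
    have "\<exists>\<phi>\<in>elementary_forms N. \<phi> h > 0" using nonzero_polymatroid_positive_form[OF fin gh(2)] nz by blast
    then obtain t where t: "t \<ge> 0" "\<forall>\<phi>\<in>elementary_forms N. \<phi> f - t * \<phi> h \<ge> 0"
      "\<exists>\<phi>\<in>elementary_forms N. \<phi> h > 0 \<and> \<phi> f - t * \<phi> h = 0"
      using ratio_test[of "elementary_forms N" "\<lambda>\<phi>. \<phi> f" "\<lambda>\<phi>. \<phi> h"] finite_elementary_forms[OF fin] pos by blast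
    define f' where "f' = (\<lambda>A. f A - t * h A)"
    have f': "\<phi> f' = \<phi> f - t * \<phi> h" if "\<phi> \<in> elementary_forms N" for \<phi>
      unfolding f'_def using elementary_forms_linear[OF that] .
    have "f' {} = 0" using less.prems gh(2) by (simp add: f'_def polymatroid_def)
    then have p': "polymatroid N f'" using poly f' t(2) by auto
    obtain \<psi> where \<psi>: "\<psi> \<in> elementary_forms N" "\<psi> h > 0" "\<psi> f' = 0" using t(3) f' by auto
    then have "\<psi> f \<noteq> 0" using split[OF \<psi>(1)] pos[OF \<psi>(1)] by linarith
    moreover have "\<phi> f' = 0" if "\<phi> \<in> elementary_forms N" "\<phi> f = 0" for \<phi>
      using f'[OF that(1)] split[OF that(1)] pos[OF that(1)] that(2) by simp
    ultimately have "{\<phi> \<in> elementary_forms N. \<phi> f' \<noteq> 0} \<subset> {\<phi> \<in> elementary_forms N. \<phi> f \<noteq> 0}"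
      using \<psi> by blast
    then have "card {\<phi> \<in> elementary_forms N. \<phi> f' \<noteq> 0} < card {\<phi> \<in> elementary_forms N. \<phi> f \<noteq> 0}"
      using finite_elementary_forms[OF fin] by (intro psubset_card_mono) auto
    from less.hyps[OF this p'] obtain g' where "reduced_polymatroid N a g'"
      "\<forall>A. A \<subseteq> N - {a} \<longrightarrow> g' (insert a A) - g' A = f' (insert a A) - f' A" by blast
    moreover have "f' (insert a A) - f' A = f (insert a A) - f A" if "A \<subseteq> N - {a}" for A
      using gh(3) that unfolding f'_def not_depends_on_def by simp
    ultimately show ?thesis by auto
  qed blast
qed

section \<open>Coordinates of points of bounded polyhedra\<close>

type_synonym 'v quad = "'v \<times> 'v \<times> 'v \<times> 'v"

text \<open>
  Gaps are linear forms of this kind. The four coordinates may coincide, and a coordinate outside of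
  the set \<open>V\<close> on which vectors are supported stands for an absent term.
\<close>

definition row :: "'v quad \<Rightarrow> ('v \<Rightarrow> 'b::comm_ring_1) \<Rightarrow> 'b" where
  "row e x = (case e of (p, q, r, s) \<Rightarrow> x p + x q - x r - x s)"

lemma row_add_mult: "row e (\<lambda>u. x u + t * y u) = row e x + t * row e y"
  by (cases e) (simp add: row_def algebra_simps)

lemma row_uminus: "row e (\<lambda>u. - x u) = - row e x"
  by (cases e) (simp add: row_def)

lemma row_sum: "row e (\<lambda>u. \<Sum>k\<in>I. c k * v k u) = (\<Sum>k\<in>I. c k * row e (v k))"
  by (cases e) (simp add: row_def algebra_simps sum.distrib sum_subtractf)

lemma row_of_int: "row e (\<lambda>u. of_int (x u)) = (of_int (row e x) :: real)"
  by (cases e) (simp add: row_def)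

definition determining :: "'v set \<Rightarrow> 'v quad set \<Rightarrow> bool" where
  "determining V S \<longleftrightarrow>
     (\<forall>x :: 'v \<Rightarrow> real. (\<forall>u. u \<notin> V \<longrightarrow> x u = 0) \<and> (\<forall>e\<in>S. row e x = 0) \<longrightarrow> (\<forall>u. x u = 0))"

lemma linear_dependency:
  fixes A :: "'i \<Rightarrow> 'v \<Rightarrow> real"
  assumes "finite V" "finite I" "card V < card I"
  shows "\<exists>c. (\<exists>i\<in>I. c i \<noteq> 0) \<and> (\<forall>u\<in>V. (\<Sum>i\<in>I. c i * A i u) = 0)"
  using assms
proof (induction V arbitrary: I A rule: finite_induct)
  case empty
  then have "I \<noteq> {}" by auto
  then show ?case by (intro exI[of _ "\<lambda>_. 1"]) auto
next
  case (insert w V)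
  show ?case
  proof (cases "\<exists>k\<in>I. A k w \<noteq> 0")
    case True
    then obtain k where k: "k \<in> I" "A k w \<noteq> 0" by blast
    let ?J = "I - {k}"
    have "card V < card ?J" using insert k by simp
    then obtain c where c: "\<exists>i\<in>?J. c i \<noteq> 0"
      "\<And>u. u \<in> V \<Longrightarrow> (\<Sum>i\<in>?J. c i * (A i u - A i w / A k w * A k u)) = 0"
      using insert.IH[of ?J "\<lambda>i u. A i u - A i w / A k w * A k u"] insert.prems by auto
    define s where "s = (\<Sum>i\<in>?J. c i * (A i w / A k w))"
    have eq: "(\<Sum>i\<in>I. (c(k := - s)) i * A i u) = (\<Sum>i\<in>?J. c i * (A i u - A i w / A k w * A k u))" for u
    proof -
      have "(\<Sum>i\<in>I. (c(k := - s)) i * A i u) = - s * A k u + (\<Sum>i\<in>?J. (c(k := - s)) i * A i u)"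
        using insert.prems k by (subst sum.remove[of I k]) auto
      also have "(\<Sum>i\<in>?J. (c(k := - s)) i * A i u) = (\<Sum>i\<in>?J. c i * A i u)"
        by (rule sum.cong) auto
      finally show ?thesis
        by (simp add: s_def algebra_simps sum_subtractf sum_distrib_left)
    qed
    have "(\<Sum>i\<in>I. (c(k := - s)) i * A i u) = 0" if "u \<in> insert w V" for u
      using that c(2) k(2) eq[of u] by auto
    moreover have "\<exists>i\<in>I. (c(k := - s)) i \<noteq> 0" using c(1) by auto
    ultimately show ?thesis by blast
  next
    case False
    obtain c where "\<exists>i\<in>I. c i \<noteq> 0" "\<forall>u\<in>V. (\<Sum>i\<in>I. c i * A i u) = 0"
      using insert.IH[of I A] insert.prems insert.hyps by auto
    then show ?thesis using False by (intro exI[of _ c]) auto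
  qed
qed

text \<open>
  In a minimal determining set every row \<open>e\<close> has a vector \<open>v e\<close> on which all other rows vanish but \<open>e\<close>
  does not. These vectors are linearly independent, so there are at most \<open>card V\<close> of them.
\<close>

lemma small_determining_subset:
  assumes "finite V" "finite S" "determining V S"
  shows "\<exists>S'\<subseteq>S. card S' \<le> card V \<and> determining V S'"
  using assms(2,3)
proof (induction S rule: finite_psubset_induct)
  case (psubset S)
  show ?case
  proof (cases "\<exists>e\<in>S. determining V (S - {e})")
    case True
    then obtain e where "e \<in> S" "determining V (S - {e})" by blast
    with psubset.IH[of "S - {e}"] show ?thesis by blast
  next
    case False
    have "\<exists>v::'a \<Rightarrow> real. (\<forall>u. u \<notin> V \<longrightarrow> v u = 0) \<and> (\<forall>e'\<in>S - {e}. row e' v = 0) \<and> row e v \<noteq> 0"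
      if "e \<in> S" for e
    proof -
      obtain v :: "'a \<Rightarrow> real" where v: "\<forall>u. u \<notin> V \<longrightarrow> v u = 0" "\<forall>e'\<in>S - {e}. row e' v = 0"
        "\<exists>u. v u \<noteq> 0"
        using False \<open>e \<in> S\<close> unfolding determining_def by blast
      have "row e v \<noteq> 0"
      proof
        assume "row e v = 0"
        then have "\<forall>e'\<in>S. row e' v = 0" using v(2) by blast
        then show False using psubset.prems v unfolding determining_def by blast
      qed
      then show ?thesis using v by blast
    qed
    then obtain v :: "'a quad \<Rightarrow> 'a \<Rightarrow> real" where v: "\<And>e u. e \<in> S \<Longrightarrow> u \<notin> V \<Longrightarrow> v e u = 0"
      "\<And>e e'. e \<in> S \<Longrightarrow> e' \<in> S \<Longrightarrow> e' \<noteq> e \<Longrightarrow> row e' (v e) = 0" "\<And>e. e \<in> S \<Longrightarrow> row e (v e) \<noteq> 0"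
      by (metis DiffI singletonD)
    have "card S \<le> card V"
    proof (rule ccontr)
      assume "\<not> card S \<le> card V"
      then obtain c where c: "\<exists>e\<in>S. c e \<noteq> 0" "\<forall>u\<in>V. (\<Sum>e\<in>S. c e * v e u) = 0"
        using linear_dependency[OF assms(1) psubset.hyps, of v] by auto
      have zero: "(\<lambda>u. \<Sum>e\<in>S. c e * v e u) = (\<lambda>_. 0)"
      proof
        fix u
        show "(\<Sum>e\<in>S. c e * v e u) = 0" using c(2) v(1) by (cases "u \<in> V") auto
      qed
      have "c e * row e (v e) = 0" if "e \<in> S" for e
      proof -
        have "(\<Sum>k\<in>S. c k * row e (v k)) = 0"
          unfolding row_sum[symmetric] zero by (cases e) (simp add: row_def)
        moreover have "(\<Sum>k\<in>S. c k * row e (v k)) = c e * row e (v e) + (\<Sum>k\<in>S - {e}. c k * row e (v k))"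
          using psubset.hyps that by (simp add: sum.remove)
        moreover have "(\<Sum>k\<in>S - {e}. c k * row e (v k)) = 0"
        proof (intro sum.neutral ballI)
          fix k assume "k \<in> S - {e}"
          then have "row e (v k) = 0" using v(2)[of k e] that by blast
          then show "c k * row e (v k) = 0" by simp
        qed
        ultimately show ?thesis by simp
      qed
      then show False using c(1) v(3) by auto
    qed
    then show ?thesis using psubset.prems by blast
  qed
qed

text \<open>
  That is, \<open>(1 + 1 / (4 d)) ^ d \<le> 2\<close>, which lets the pigeonhole argument below afford ranges slightly
  longer than \<open>4 B\<close> for the values of the rows.
\<close>

lemma Suc_four_mult_power_le: "(4 * d + 1) ^ d \<le> 2 * (4 * d) ^ d" for d :: nat
proof -
  let ?x = "- 1 / (4 * real d + 1)"
  have "1 / 2 \<le> 1 + real d * ?x" by (simp add: field_simps)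
  also have "\<dots> \<le> (1 + ?x) ^ d" by (rule Bernoulli_inequality) (simp add: field_simps)
  also have "1 + ?x = real (4 * d) / real (4 * d + 1)" by (simp add: field_simps)
  finally have "real ((4 * d + 1) ^ d) \<le> real (2 * (4 * d) ^ d)"
    by (simp add: power_divide field_simps)
  then show ?thesis using of_nat_le_iff by blast
qed

text \<open>The number of values that a coordinate is given in the pigeonhole argument below.\<close>

definition vertex_bound :: "nat \<Rightarrow> nat" where
  "vertex_bound d = d * (2 * 4 ^ d)"

text \<open>
  A version of Siegel's lemma. Consider the integral pairs \<open>(x, t)\<close> with coordinates \<open>0 \<le> x u \<le> B\<close> and
  \<open>0 \<le> t \<le> T\<close>. Every \<open>row e x + c e * t\<close> then takes at most \<open>4 B + T + 1\<close> values, so for suitable \<open>B\<close>, \<open>T\<close>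
  there are more pairs than value vectors, and the difference of two pairs with the same values is a
  solution. Treating \<open>t\<close> with a range of its own, shorter than that of \<open>x\<close> by the factor \<open>d\<close>, keeps the
  base of the exponential bound at 4 although a row with constant term 1 has five nonzero
  coefficients.
\<close>

lemma small_integer_solution:
  fixes c :: "'v quad \<Rightarrow> int"
  assumes V: "finite V" "V \<noteq> {}" and S: "finite S" "card S \<le> card V"
    and c: "\<And>e. e \<in> S \<Longrightarrow> c e \<in> {0, 1}"
  shows "\<exists>(x :: 'v \<Rightarrow> int) t. (t \<noteq> 0 \<or> (\<exists>u. x u \<noteq> 0)) \<and> (\<forall>u. u \<notin> V \<longrightarrow> x u = 0) \<and>
    (\<forall>u. \<bar>x u\<bar> < int (vertex_bound (card V))) \<and> (\<forall>e\<in>S. row e x + c e * t = 0)"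
proof -
  define d where "d = card V"
  have d: "d \<ge> 1" using V by (simp add: d_def Suc_le_eq card_gt_0_iff)
  define T where "T = 2 * (4::nat) ^ d"
  define B where "B = d * T - 1"
  have T: "T \<ge> 1" by (simp add: T_def)
  have B1: "B + 1 = d * T" using d T by (simp add: B_def)
  let ?F = "(V \<rightarrow>\<^sub>E {0..int B}) \<times> {0..int T}"
  define ext where "ext = (\<lambda>x u. if u \<in> V then x u else (0::int))"
  define G where "G = (\<lambda>(x, t). \<lambda>e\<in>S. row e (ext x) + c e * t)"
  let ?R = "{- 2 * int B..2 * int B + int T}"
  have card_R: "card ?R = 4 * B + T + 1" by simp
  have "G ` ?F \<subseteq> S \<rightarrow>\<^sub>E ?R"
  proof (rule image_subsetI)
    fix xt assume "xt \<in> ?F"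
    then obtain x t where xt: "xt = (x, t)" "x \<in> V \<rightarrow>\<^sub>E {0..int B}" "t \<in> {0..int T}" by blast
    have ext: "0 \<le> ext x u" "ext x u \<le> int B" for u using xt(2) by (auto simp: ext_def PiE_def Pi_def)
    have "row e (ext x) + c e * t \<in> ?R" if "e \<in> S" for e
    proof -
      obtain p q r s where e: "e = (p, q, r, s)" by (cases e)
      have "c e * t \<ge> 0" "c e * t \<le> int T" using c[OF that] xt(3) by auto
      then show ?thesis using ext[of p] ext[of q] ext[of r] ext[of s] unfolding e by (simp add: row_def)
    qed
    then show "G xt \<in> S \<rightarrow>\<^sub>E ?R" by (simp add: G_def xt(1))
  qed
  then have "card (G ` ?F) \<le> card (S \<rightarrow>\<^sub>E ?R)"
    by (intro card_mono finite_PiE S) auto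
  also have "\<dots> = (4 * B + T + 1) ^ card S"
    using card_R S by (simp add: card_PiE)
  also have "\<dots> \<le> (4 * B + T + 1) ^ d" using S by (intro power_increasing) (auto simp: d_def)
  also have "\<dots> \<le> (T * (4 * d + 1)) ^ d"
  proof (rule power_mono)
    have "4 * B + T + 1 \<le> 4 * (B + 1) + T" by simp
    also have "\<dots> = T * (4 * d + 1)" unfolding B1 by (simp add: algebra_simps)
    finally show "4 * B + T + 1 \<le> T * (4 * d + 1)" .
  qed simp
  also have "\<dots> \<le> T ^ d * (2 * (4 * d) ^ d)"
    unfolding power_mult_distrib using Suc_four_mult_power_le[of d] by simp
  also have "\<dots> = (d * T) ^ d * T" by (simp add: T_def power_mult_distrib)
  also have "\<dots> < (B + 1) ^ d * (T + 1)" unfolding B1 using d T by simp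
  also have "\<dots> = card ?F"
    using V by (simp add: card_cartesian_product card_PiE d_def nat_add_distrib)
  finally have "\<not> inj_on G ?F" by (rule pigeonhole)
  then obtain x t y s where xy: "(x, t) \<in> ?F" "(y, s) \<in> ?F" "(x, t) \<noteq> (y, s)" "G (x, t) = G (y, s)"
    unfolding inj_on_def by fast
  define z where "z = (\<lambda>u. ext x u - ext y u)"
  have range: "0 \<le> ext x u" "ext x u \<le> int B" "0 \<le> ext y u" "ext y u \<le> int B" for u
    using xy(1,2) by (auto simp: ext_def PiE_def Pi_def)
  have "\<bar>z u\<bar> < int (vertex_bound (card V))" for u
  proof -
    have "\<bar>z u\<bar> < int (B + 1)" using range[of u] by (simp add: z_def)
    then show ?thesis unfolding B1 by (simp add: vertex_bound_def T_def d_def)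
  qed
  moreover have "row e z + c e * (t - s) = 0" if "e \<in> S" for e
  proof -
    have "row e (ext x) + c e * t = row e (ext y) + c e * s"
      using fun_cong[OF xy(4), of e] that by (simp add: G_def)
    moreover have "row e z = row e (ext x) - row e (ext y)" by (cases e) (simp add: row_def z_def)
    ultimately show ?thesis by (simp add: algebra_simps)
  qed
  moreover have "t - s \<noteq> 0 \<or> (\<exists>u. z u \<noteq> 0)"
  proof (cases "x = y")
    case False
    then obtain u where "x u \<noteq> y u" by blast
    moreover have "u \<in> V"
    proof (rule ccontr)
      assume "u \<notin> V"
      then have "x u = undefined" "y u = undefined"
        using xy(1,2) PiE_arb[of x V _ u] PiE_arb[of y V _ u] by auto
      then show False using \<open>x u \<noteq> y u\<close> by simp
    qed
    ultimately have "z u \<noteq> 0" by (simp add: z_def ext_def)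
    then show ?thesis by blast
  qed (use xy(3) in simp)
  moreover have "z u = 0" if "u \<notin> V" for u using that by (simp add: z_def ext_def)
  ultimately show ?thesis by blast
qed

text \<open>
  As long as the constraints tight at \<open>x\<close> do not determine \<open>x\<close>, there is a line through \<open>x\<close> on which they
  stay tight. Follow it in the direction in which coordinate \<open>w\<close> does not decrease. Since the polyhedron
  has no direction of recession, another constraint becomes tight on the way.
  A pair \<open>(e, c)\<close> stands for the constraint \<open>row e x + c \<ge> 0\<close>.
\<close>

lemma exists_vertex_above:
  fixes x :: "'v \<Rightarrow> real" and C :: "('v quad \<times> real) set"
  assumes C: "finite C"
    and pointed: "\<And>z :: 'v \<Rightarrow> real. (\<And>u. u \<notin> V \<Longrightarrow> z u = 0) \<Longrightarrow> (\<And>e c. (e, c) \<in> C \<Longrightarrow> row e z \<ge> 0) \<Longrightarrow> \<forall>u. z u = 0"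
    and x: "\<And>u. u \<notin> V \<Longrightarrow> x u = 0" "\<And>e c. (e, c) \<in> C \<Longrightarrow> row e x + c \<ge> 0"
  shows "\<exists>y. (\<forall>u. u \<notin> V \<longrightarrow> y u = 0) \<and> y w \<ge> x w \<and>
    determining V {e. \<exists>c. (e, c) \<in> C \<and> row e y + c = 0}"
  using x
proof (induction "card {k \<in> C. row (fst k) x + snd k \<noteq> 0}" arbitrary: x rule: less_induct)
  case less
  let ?T = "\<lambda>x. {e. \<exists>c. (e, c) \<in> C \<and> row e x + c = 0}"
  show ?case
  proof (cases "determining V (?T x)")
    case True
    then show ?thesis using less.prems by blast
  next
    case False
    then obtain v0 :: "'v \<Rightarrow> real" where v0: "\<forall>u. u \<notin> V \<longrightarrow> v0 u = 0" "\<forall>e\<in>?T x. row e v0 = 0"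
      "\<exists>u. v0 u \<noteq> 0" unfolding determining_def by blast
    define v where "v = (if v0 w \<ge> 0 then v0 else (\<lambda>u. - v0 u))"
    have v: "\<And>u. u \<notin> V \<Longrightarrow> v u = 0" "\<And>e. e \<in> ?T x \<Longrightarrow> row e v = 0" "\<exists>u. v u \<noteq> 0" "v w \<ge> 0"
    proof -
      show "v u = 0" if "u \<notin> V" for u using v0(1) that by (simp add: v_def)
      show "row e v = 0" if "e \<in> ?T x" for e
        using bspec[OF v0(2) that] by (simp add: v_def row_uminus)
    qed (use v0(3) in \<open>auto simp: v_def\<close>)
    have feasible: "row (fst k) x + snd k \<ge> 0" if "k \<in> C" for k
      using less.prems(2)[of "fst k" "snd k"] that by simp
    have "\<exists>k\<in>C. - row (fst k) v > 0"
    proof (rule ccontr)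
      assume "\<not> ?thesis"
      then have "row e v \<ge> 0" if "(e, c) \<in> C" for e c using that by fastforce
      then show False using pointed[of v] v by blast
    qed
    then obtain t where t: "t \<ge> 0"
      "\<forall>k\<in>C. row (fst k) x + snd k - t * - row (fst k) v \<ge> 0"
      "\<exists>k\<in>C. - row (fst k) v > 0 \<and> row (fst k) x + snd k - t * - row (fst k) v = 0"
      using ratio_test[OF C, of "\<lambda>k. row (fst k) x + snd k" "\<lambda>k. - row (fst k) v"] feasible
      by blast
    define y where "y = (\<lambda>u. x u + t * v u)"
    have row_y: "row e y = row e x + t * row e v" for e by (simp add: y_def row_add_mult)
    have y: "\<And>u. u \<notin> V \<Longrightarrow> y u = 0" "\<And>e c. (e, c) \<in> C \<Longrightarrow> row e y + c \<ge> 0" "y w \<ge> x w"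
    proof -
      show "y u = 0" if "u \<notin> V" for u using that less.prems(1) v(1) by (simp add: y_def)
      show "row e y + c \<ge> 0" if "(e, c) \<in> C" for e c
        using bspec[OF t(2) that] by (simp add: row_y)
      show "y w \<ge> x w" using t(1) v(4) by (simp add: y_def)
    qed
    obtain k where k: "k \<in> C" "- row (fst k) v > 0" "row (fst k) y + snd k = 0"
      using t(3) by (auto simp: row_y algebra_simps)
    have "row (fst k) x + snd k \<noteq> 0"
    proof
      assume "row (fst k) x + snd k = 0"
      then have "fst k \<in> ?T x" using k(1) by (cases k) auto
      then show False using v(2) k(2) by simp
    qed
    moreover have "row (fst l) y + snd l = 0" if "l \<in> C" "row (fst l) x + snd l = 0" for l
    proof -
      have "fst l \<in> ?T x" using that by (cases l) auto
      then show ?thesis using that(2) v(2) by (simp add: row_y)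
    qed
    ultimately have "{k \<in> C. row (fst k) y + snd k \<noteq> 0} \<subset> {k \<in> C. row (fst k) x + snd k \<noteq> 0}"
      using k by blast
    then have "card {k \<in> C. row (fst k) y + snd k \<noteq> 0} < card {k \<in> C. row (fst k) x + snd k \<noteq> 0}"
      using C by (intro psubset_card_mono) auto
    from less.hyps[OF this y(1,2)] obtain z where "\<forall>u. u \<notin> V \<longrightarrow> z u = 0" "z w \<ge> y w"
      "determining V (?T z)" by blast
    then show ?thesis using y(3) by (intro exI[of _ z]) auto
  qed
qed

text \<open>
  At a vertex \<open>y\<close> choose at most \<open>card V\<close> tight constraints that determine it. A small nonzero integral
  solution \<open>(z, t)\<close> of the homogenized system satisfies \<open>z = t y\<close>, because \<open>z - t y\<close> is in the kernel of the
  determining rows; then \<open>t \<noteq> 0\<close>, and so \<open>\<bar>y w\<bar> \<le> \<bar>z w\<bar>\<close>.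
\<close>

theorem bounded_polyhedron_coordinate_bound:
  fixes x :: "'v \<Rightarrow> real" and C :: "('v quad \<times> real) set"
  assumes V: "finite V" "V \<noteq> {}" and C: "finite C" "\<And>e c. (e, c) \<in> C \<Longrightarrow> c \<in> {0, 1}"
    and pointed: "\<And>z :: 'v \<Rightarrow> real. (\<And>u. u \<notin> V \<Longrightarrow> z u = 0) \<Longrightarrow> (\<And>e c. (e, c) \<in> C \<Longrightarrow> row e z \<ge> 0) \<Longrightarrow> \<forall>u. z u = 0"
    and x: "\<And>u. u \<notin> V \<Longrightarrow> x u = 0" "\<And>e c. (e, c) \<in> C \<Longrightarrow> row e x + c \<ge> 0"
  shows "x w \<le> real (vertex_bound (card V)) - 1"
proof -
  obtain y where y: "\<forall>u. u \<notin> V \<longrightarrow> y u = 0" "y w \<ge> x w"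
    "determining V {e. \<exists>c. (e, c) \<in> C \<and> row e y + c = 0}" (is "determining V ?T")
    using exists_vertex_above[OF C(1) pointed x] by blast
  have "?T \<subseteq> fst ` C" by force
  then have finT: "finite ?T" using C(1) finite_surj by blast
  obtain S where S: "S \<subseteq> ?T" "card S \<le> card V" "determining V S"
    using small_determining_subset[OF V(1) finT y(3)] by blast
  define c where "c = (\<lambda>e. if row e y = 0 then 0 else 1 :: int)"
  have c: "row e y + of_int (c e) = 0" if e: "e \<in> S" for e
  proof -
    obtain k where "(e, k) \<in> C" "row e y + k = 0" using e S(1) by blast
    then show ?thesis using C(2)[of e k] by (auto simp: c_def)
  qed
  have c01: "c e \<in> {0, 1}" for e by (simp add: c_def)
  obtain z :: "'v \<Rightarrow> int" and t where z: "t \<noteq> 0 \<or> (\<exists>u. z u \<noteq> 0)" "\<forall>u. u \<notin> V \<longrightarrow> z u = 0"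
    "\<forall>u. \<bar>z u\<bar> < int (vertex_bound (card V))" "\<forall>e\<in>S. row e z + c e * t = 0"
    using small_integer_solution[OF V finite_subset[OF S(1) finT] S(2), of c] c01 by blast
  define r where "r = (\<lambda>u. of_int (z u) + (- of_int t) * y u :: real)"
  have "\<forall>u. r u = 0"
  proof -
    have "row e r = 0" if "e \<in> S" for e
    proof -
      have "row e r = of_int (row e z) - of_int t * row e y"
        unfolding r_def row_add_mult row_of_int by simp
      also have "row e y = - of_int (c e)" using c[OF that] by simp
      also have "of_int (row e z) - of_int t * - of_int (c e) = (of_int (row e z + c e * t) :: real)"
        by simp
      finally show ?thesis using z(4) that by simp
    qed
    moreover have "\<forall>u. u \<notin> V \<longrightarrow> r u = 0" using y(1) z(2) by (simp add: r_def)
    ultimately show ?thesis using S(3) unfolding determining_def by blast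
  qed
  then have zy: "of_int (z u) = of_int t * y u" for u by (simp add: r_def)
  have "t \<noteq> 0"
  proof
    assume "t = 0"
    then have "z u = 0" for u using zy[of u] by simp
    then show False using z(1) \<open>t = 0\<close> by blast
  qed
  then have "\<bar>of_int t :: real\<bar> \<ge> 1" by linarith
  then have "1 * \<bar>y w\<bar> \<le> \<bar>of_int t\<bar> * \<bar>y w\<bar>" by (intro mult_right_mono) auto
  also have "\<dots> = \<bar>of_int (z w)\<bar>" using zy[of w] by (simp add: abs_mult)
  also have "\<dots> \<le> of_int (int (vertex_bound (card V)) - 1)"
    using z(3)[rule_format, of w] by linarith
  finally have "\<bar>y w\<bar> \<le> real (vertex_bound (card V)) - 1" by simp
  then show ?thesis using y(2) by linarith
qed

section \<open>Singletons of reduced polymatroids are bounded\<close>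

text \<open>
  Extended to \<open>N\<close> by ignoring \<open>a\<close>, the function \<open>h\<close> has gap 0 at the triples \<open>(i, j, K)\<close> with
  \<open>a \<in> {i, j}\<close>, and its gap at \<open>K\<close> or \<open>aK\<close> is that of \<open>h\<close> at \<open>K\<close>. The hypotheses thus say that every elementary form positive at
  this extension is positive at \<open>f\<close>, so that a small multiple of the extension can be split off from \<open>f\<close>.
\<close>

lemma reduced_no_free_direction:
  assumes fin: "finite N" and a: "a \<in> N" and red: "reduced_polymatroid N a f"
    and h: "polymatroid (N - {a}) h"
    and gaps: "\<And>i j K. i \<in> N - {a} \<Longrightarrow> j \<in> N - {a} \<Longrightarrow> i \<noteq> j \<Longrightarrow> K \<subseteq> N - {a} - {i, j} \<Longrightarrow>
      gap h i j K > 0 \<Longrightarrow> gap f i j K > 0 \<and> gap f i j (insert a K) > 0"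
    and top: "\<And>i. i \<in> N - {a} \<Longrightarrow> h (N - {a} - {i}) < h (N - {a}) \<Longrightarrow> f (N - {i}) < f N"
    and A: "A \<subseteq> N - {a}"
  shows "h A = 0"
proof -
  define h' where "h' = (\<lambda>A. h (A - {a}))"
  have f: "polymatroid N f" using red by (simp add: reduced_polymatroid_def)
  have h': "polymatroid N h'"
    unfolding polymatroid_def
  proof (intro conjI allI impI)
    show "h' {} = 0" using h by (simp add: h'_def polymatroid_def)
  next
    fix A B assume "A \<subseteq> B \<and> B \<subseteq> N"
    then show "h' A \<le> h' B" unfolding h'_def by (intro polymatroid_mono[OF h]) auto
  next
    fix A B assume AB: "A \<subseteq> N \<and> B \<subseteq> N"
    have "(A - {a}) \<inter> (B - {a}) = A \<inter> B - {a}" "(A - {a}) \<union> (B - {a}) = A \<union> B - {a}" by auto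
    moreover have "A - {a} \<subseteq> N - {a}" "B - {a} \<subseteq> N - {a}" using AB by auto
    ultimately show "h' (A \<inter> B) + h' (A \<union> B) \<le> h' A + h' B"
      using polymatroid_submod[OF h, of "A - {a}" "B - {a}"] unfolding h'_def by simp
  qed
  note poly = polymatroid_iff_forms[OF fin]
  have pos: "\<phi> f > 0" if \<phi>: "\<phi> \<in> elementary_forms N" and gt: "\<phi> h' > 0" for \<phi>
  proof -
    consider i j K where "\<phi> = (\<lambda>f. gap f i j K)" "i \<in> N" "j \<in> N" "i \<noteq> j" "K \<subseteq> N - {i, j}"
      | i where "\<phi> = (\<lambda>f. f N - f (N - {i}))" "i \<in> N"
      using \<phi> unfolding elementary_forms_def by blast
    then show ?thesis
    proof cases
      case 1
      have "gap h' i j K = 0" if "i = a \<or> j = a"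
        using that by (auto simp: gap_def h'_def insert_Diff_if)
      then have ij: "i \<noteq> a" "j \<noteq> a" using gt 1(1) by auto
      then have "gap h' i j K = gap h i j (K - {a})"
        by (simp add: gap_def h'_def insert_Diff_if)
      then have "gap f i j (K - {a}) > 0 \<and> gap f i j (insert a (K - {a})) > 0"
        using gt 1 ij by (intro gaps) auto
      then show ?thesis using 1(1) by (cases "a \<in> K") (auto simp: insert_absorb)
    next
      case 2
      have "i \<noteq> a" using gt 2 by (auto simp: h'_def)
      moreover have "N - {i} - {a} = N - {a} - {i}" by blast
      ultimately show ?thesis using top[of i] gt 2 by (auto simp: h'_def)
    qed
  qed
  have "\<exists>t>0. \<forall>\<phi>\<in>elementary_forms N. \<phi> f - t * \<phi> h' \<ge> 0"
    using pos f poly by (intro small_step finite_elementary_forms fin) auto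
  then obtain t where t: "t > 0" "\<And>\<phi>. \<phi> \<in> elementary_forms N \<Longrightarrow> \<phi> f - t * \<phi> h' \<ge> 0" by blast
  define g where "g = (\<lambda>A. f A - t * h' A)"
  have "\<phi> g \<ge> 0" if "\<phi> \<in> elementary_forms N" for \<phi>
    unfolding g_def elementary_forms_linear[OF that] using t(2)[OF that] .
  moreover have "g {} = 0" using f h' by (simp add: g_def polymatroid_def)
  ultimately have "polymatroid N g" using poly by blast
  moreover have "polymatroid N (\<lambda>A. t * h' A)"
    unfolding polymatroid_def
  proof (intro conjI allI impI)
    show "t * h' {} = 0" using h' by (simp add: polymatroid_def)
  next
    fix A B assume "A \<subseteq> B \<and> B \<subseteq> N"
    then show "t * h' A \<le> t * h' B"
      using t(1) polymatroid_mono[OF h', of A B] by (intro mult_left_mono) auto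
  next
    fix A B assume "A \<subseteq> N \<and> B \<subseteq> N"
    then have "t * (h' (A \<inter> B) + h' (A \<union> B)) \<le> t * (h' A + h' B)"
      using t(1) polymatroid_submod[OF h', of A B] by (intro mult_left_mono) auto
    then show "t * h' (A \<inter> B) + t * h' (A \<union> B) \<le> t * h' A + t * h' B"
      by (simp add: algebra_simps)
  qed
  moreover have "not_depends_on N a (\<lambda>A. t * h' A)"
    unfolding not_depends_on_def h'_def by auto
  moreover have "\<forall>A. A \<subseteq> N \<longrightarrow> f A = g A + t * h' A" by (simp add: g_def)
  ultimately have "\<forall>A. A \<subseteq> N \<longrightarrow> t * h' A = 0"
    using red unfolding reduced_polymatroid_def by blast
  moreover have "A \<subseteq> N" "A - {a} = A" using A by auto
  ultimately show ?thesis using t(1) by (auto simp: h'_def)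
qed

text \<open>
  Otherwise the function \<open>[i \<in> A]\<close> could be split off: it is modular, so all its gaps vanish, and among
  the remaining elementary forms only \<open>f(N) - f(N - i)\<close> is positive at it.
\<close>

lemma reduced_tight:
  assumes fin: "finite N" and a: "a \<in> N" and red: "reduced_polymatroid N a f"
    and i: "i \<in> N - {a}"
  shows "f (N - {i}) = f N"
proof (rule ccontr)
  assume "f (N - {i}) \<noteq> f N"
  moreover have "polymatroid N f" using red by (simp add: reduced_polymatroid_def)
  ultimately have lt: "f (N - {i}) < f N" using polymatroid_mono[of N f "N - {i}" N] by force
  define h where "h = (\<lambda>A. if i \<in> A then 1 else 0 :: real)"
  have gap: "gap h k j K = 0" if "k \<noteq> j" "K \<subseteq> N - {a} - {k, j}" for k j K
    using that by (auto simp: gap_def h_def)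
  have "polymatroid (N - {a}) h"
    by (rule polymatroidI) (use fin gap in \<open>auto simp: h_def\<close>)
  then have "h {i} = 0"
    by (rule reduced_no_free_direction[OF fin a red]) (use gap lt i in \<open>auto simp: h_def split: if_splits\<close>)
  then show False by (simp add: h_def)
qed

text \<open>
  With \<open>d(X) = f(aX) - f(X)\<close>, the gap at \<open>K\<close> exceeds the gap at \<open>aK\<close> by
  \<open>d(K) - d(jK) - (d(iK) - d(ijK))\<close>. This is at most \<open>d(K) \<le> f(a)\<close>, since \<open>d\<close> is nonnegative and
  decreasing.
\<close>

lemma gap_le_if_dead:
  assumes f: "polymatroid N f" and a: "a \<in> N" and ij: "i \<in> N - {a}" "j \<in> N - {a}" "i \<noteq> j"
    and K: "K \<subseteq> N - {a} - {i, j}" and dead: "gap f i j K = 0 \<or> gap f i j (insert a K) = 0"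
  shows "gap f i j K \<le> f {a}"
proof -
  have "f (insert a K) + f {} \<le> f {a} + f K"
  proof -
    have "{a} \<inter> K = {}" "{a} \<union> K = insert a K" "{a} \<subseteq> N" "K \<subseteq> N" using a K by auto
    then show ?thesis using polymatroid_submod[OF f, of "{a}" K] by simp
  qed
  moreover have "gap f a j (insert i K) \<ge> 0"
    by (rule polymatroid_gap[OF f]) (use a ij K in auto)
  moreover have "f (insert j K) \<le> f (insert a (insert j K))"
    by (rule polymatroid_mono[OF f]) (use a ij K in auto)
  moreover have "f {} = 0" "f {a} \<ge> 0"
    using f polymatroid_mono[OF f, of "{}" "{a}"] a by (auto simp: polymatroid_def)
  ultimately show ?thesis
    using dead by (auto simp: gap_def insert_commute)
qed

lemma card_coordinates_le:
  assumes "finite M" "card M = m" "m \<ge> 2"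
  shows "card {A. A \<subseteq> M \<and> A \<noteq> {} \<and> card A \<noteq> m - 1} \<le> 2 ^ m - 1 - m"
proof -
  let ?R = "insert {} ((\<lambda>i. M - {i}) ` M)"
  have "inj_on (\<lambda>i. M - {i}) M" by (auto simp: inj_on_def)
  moreover have "{} \<notin> (\<lambda>i. M - {i}) ` M"
  proof
    assume "{} \<in> (\<lambda>i. M - {i}) ` M"
    then obtain i where "M \<subseteq> {i}" by blast
    then have "card M \<le> 1" using card_mono[of "{i}" M] by simp
    then show False using assms by simp
  qed
  ultimately have "card ?R = m + 1" using assms by (simp add: card_image)
  have "{A. A \<subseteq> M \<and> A \<noteq> {} \<and> card A \<noteq> m - 1} \<subseteq> Pow M - ?R" using assms by auto
  then have "card {A. A \<subseteq> M \<and> A \<noteq> {} \<and> card A \<noteq> m - 1} \<le> card (Pow M - ?R)"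
    using assms(1) by (intro card_mono) auto
  also have "\<dots> = card (Pow M) - card ?R"
    by (rule card_Diff_subset) (use assms(1) in auto)
  also have "\<dots> = 2 ^ m - 1 - m" using \<open>card ?R = m + 1\<close> assms by (simp add: card_Pow)
  finally show ?thesis .
qed

lemma vertex_bound_mono: "c \<le> d \<Longrightarrow> vertex_bound c \<le> vertex_bound d"
  unfolding vertex_bound_def by (rule mult_le_mono) (auto intro: power_increasing)

text \<open>
  The coordinates are chosen as follows. A function on the subsets of \<open>M\<close> vanishing at the empty set and
  with equal values at \<open>M\<close> and all \<open>M - {i}\<close> is given by its values at the members of \<open>V\<close>; the map \<open>\<rho>\<close> sends a
  subset of \<open>M\<close> to the coordinate that carries its value. The empty set is outside of \<open>V\<close>, where vectors are
  zero by convention. Dropping the \<open>m\<close> sets \<open>M - {i}\<close> from the coordinates is essential for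
  \<open>vertex_bound_less\<close>.
\<close>

theorem reduced_singleton_bound:
  fixes f :: "'a set \<Rightarrow> real"
  assumes fin: "finite N" and a: "a \<in> N" and red: "reduced_polymatroid N a f" and pos: "f {a} > 0"
    and b: "b \<in> N - {a}" and m: "card (N - {a}) = m" "m \<ge> 2"
  shows "f {b} \<le> real (vertex_bound (2 ^ m - 1 - m)) * f {a}"
proof -
  define M where "M = N - {a}"
  have M: "finite M" "card M = m" "a \<notin> M" "insert a M = N" using fin a m by (auto simp: M_def)
  have f: "polymatroid N f" using red by (simp add: reduced_polymatroid_def)
  have fM: "gap f i j K \<ge> 0" "gap f i j (insert a K) \<ge> 0"
    if "i \<in> M" "j \<in> M" "i \<noteq> j" "K \<subseteq> M - {i, j}" for i j K
    by (rule polymatroid_gap[OF f]; use that M_def a in auto)+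
  \<comment> \<open>The modular part of f on M; ft is what remains, with the same gaps.\<close>
  define y where "y = (\<lambda>i. f M - f (M - {i}))"
  have y: "y i \<le> f {a}" if "i \<in> M" for i
  proof -
    have "f M \<le> f N" by (rule polymatroid_mono[OF f, of M N]) (auto simp: M_def)
    also have "\<dots> = f (N - {i})" using reduced_tight[OF fin a red] that by (simp add: M_def)
    also have "N - {i} = {a} \<union> (M - {i})" using a that by (auto simp: M_def)
    finally have "f M \<le> f ({a} \<union> (M - {i}))" .
    moreover have "f ({a} \<inter> (M - {i})) + f ({a} \<union> (M - {i})) \<le> f {a} + f (M - {i})"
      by (rule polymatroid_submod[OF f]) (use a in \<open>auto simp: M_def\<close>)
    moreover have "{a} \<inter> (M - {i}) = {}" using M by auto
    ultimately show ?thesis using f by (simp add: y_def polymatroid_def)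
  qed
  define ft where "ft = (\<lambda>A. f A - (\<Sum>i\<in>A. y i))"
  have gap_ft: "gap ft i j K = gap f i j K" if "i \<noteq> j" "K \<subseteq> M - {i, j}" for i j K
  proof -
    have "finite K" using that M(1) by (meson finite_Diff finite_subset)
    moreover have "i \<notin> K" "j \<notin> K" using that by auto
    ultimately show ?thesis using that(1) by (simp add: gap_def ft_def)
  qed
  have ft_tight: "ft (M - {i}) = ft M" if "i \<in> M" for i
    using that M(1) by (simp add: ft_def sum.remove[of M i] y_def)
  have ft_empty: "ft {} = 0" using f by (simp add: ft_def polymatroid_def)

  define \<rho> where "\<rho> = (\<lambda>A. if card A + 1 \<ge> m then M else A)"
  define V where "V = {A. A \<subseteq> M \<and> A \<noteq> {} \<and> card A \<noteq> m - 1}"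
  have V: "finite V" "M \<in> V" using M m by (auto simp: V_def)
  have full: "A = M" if "A \<subseteq> M" "card A = m" for A
    using that M by (simp add: card_subset_eq)
  have \<rho>_full: "\<rho> M = M" "\<And>i. i \<in> M \<Longrightarrow> \<rho> (M - {i}) = M" and \<rho>_empty: "\<rho> {} = {}"
    using M m by (auto simp: \<rho>_def)
  have \<rho>_V: "\<rho> A = A" if "A \<in> V" for A
  proof -
    have "card A \<le> m" using that M card_mono[of M A] by (auto simp: V_def)
    then show ?thesis using that full[of A] by (auto simp: \<rho>_def V_def)
  qed
  have \<rho>_cases: "A = {} \<or> (\<exists>i\<in>M. A = M - {i}) \<or> A \<in> V" if "A \<subseteq> M" for A
  proof (cases "card A = m - 1")
    case True
    have "card (M - A) = 1"
      using True M m that by (simp add: card_Diff_subset finite_subset)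
    then obtain i where "M - A = {i}" by (meson card_1_singletonE)
    then have "i \<in> M" "A = M - {i}" using that by auto
    then show ?thesis by blast
  qed (use that in \<open>auto simp: V_def\<close>)
  define x where "x = (\<lambda>A. if A \<in> V then ft A / f {a} else 0)"
  have x\<rho>: "x (\<rho> A) = ft A / f {a}" if "A \<subseteq> M" for A
    using \<rho>_cases[OF that] V(2) \<rho>_full \<rho>_empty \<rho>_V ft_tight ft_empty
    by (auto simp: x_def)

  \<comment> \<open>The forms whose values are the gap and its negative.\<close>
  define up where "up = (\<lambda>(i, j, K). (\<rho> (insert i K), \<rho> (insert j K), \<rho> K, \<rho> (insert i (insert j K))))"
  define dn where "dn = (\<lambda>(i, j, K). (\<rho> K, \<rho> (insert i (insert j K)), \<rho> (insert i K), \<rho> (insert j K)))"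
  have up: "row (up (i, j, K)) z = gap (\<lambda>A. z (\<rho> A)) i j K" for i j K and z :: "'a set \<Rightarrow> real"
    by (simp add: up_def row_def gap_def)
  have dn: "row (dn (i, j, K)) z = - gap (\<lambda>A. z (\<rho> A)) i j K" for i j K and z :: "'a set \<Rightarrow> real"
    by (simp add: dn_def row_def gap_def)
  define I where "I = {(i, j, K). i \<in> M \<and> j \<in> M \<and> i \<noteq> j \<and> K \<subseteq> M - {i, j}}"
  define D where "D = {(i, j, K). (i, j, K) \<in> I \<and> (gap f i j K = 0 \<or> gap f i j (insert a K) = 0)}"
  have "I \<subseteq> M \<times> M \<times> Pow M" by (auto simp: I_def)
  then have "finite I" using M(1) by (simp add: finite_subset)
  moreover have "D \<subseteq> I" by (auto simp: D_def)
  ultimately have fin_ID: "finite I" "finite D" using finite_subset by auto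
  define C where "C = (\<lambda>k. (up k, 0 :: real)) ` I \<union> (\<lambda>k. (dn k, 1)) ` D"
  have C_cases: "(\<exists>i j K. e = up (i, j, K) \<and> c = 0 \<and> (i, j, K) \<in> I) \<or>
      (\<exists>i j K. e = dn (i, j, K) \<and> c = 1 \<and> (i, j, K) \<in> D)" if "(e, c) \<in> C" for e c
    using that by (auto simp: C_def)

  have "x (\<rho> {b}) \<le> real (vertex_bound (card V)) - 1"
  proof (rule bounded_polyhedron_coordinate_bound)
    show "finite V" "V \<noteq> {}" using V by auto
    show "finite C" using fin_ID by (simp add: C_def)
    show "c \<in> {0, 1}" if "(e, c) \<in> C" for e c using C_cases[OF that] by auto
    show "x u = 0" if "u \<notin> V" for u using that by (simp add: x_def)
  next
    fix z :: "'a set \<Rightarrow> real"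
    assume supp: "\<And>u. u \<notin> V \<Longrightarrow> z u = 0" and rows: "\<And>e c. (e, c) \<in> C \<Longrightarrow> row e z \<ge> 0"
    define h where "h = (\<lambda>A. z (\<rho> A))"
    have gap_h: "gap h i j K \<ge> 0" if "(i, j, K) \<in> I" for i j K
      using rows[of "up (i, j, K)" 0] that up[of i j K z] by (auto simp: C_def h_def)
    have gap_dead: "gap h i j K \<le> 0" if "(i, j, K) \<in> D" for i j K
      using rows[of "dn (i, j, K)" 1] that dn[of i j K z] by (auto simp: C_def h_def)
    have h: "polymatroid M h"
    proof (rule polymatroidI[OF M(1)])
      show "h {} = 0" unfolding h_def \<rho>_empty by (rule supp) (simp add: V_def)
      show "h (M - {i}) \<le> h M" if "i \<in> M" for i using that by (simp add: h_def \<rho>_full)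
      show "gap h i j K \<ge> 0" if "i \<in> M" "j \<in> M" "i \<noteq> j" "K \<subseteq> M - {i, j}" for i j K
        by (rule gap_h) (use that in \<open>auto simp: I_def\<close>)
    qed
    have zero: "h A = 0" if "A \<subseteq> M" for A
    proof (rule reduced_no_free_direction[OF fin a red])
      show "polymatroid (N - {a}) h" using h by (simp add: M_def)
      show "A \<subseteq> N - {a}" using that by (simp add: M_def)
      show "f (N - {i}) < f N" if "i \<in> N - {a}" "h (N - {a} - {i}) < h (N - {a})" for i
        using that by (simp add: h_def \<rho>_full flip: M_def)
      show "gap f i j K > 0 \<and> gap f i j (insert a K) > 0"
        if "i \<in> N - {a}" "j \<in> N - {a}" "i \<noteq> j" "K \<subseteq> N - {a} - {i, j}" "gap h i j K > 0" for i j K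
      proof -
        have ijK: "i \<in> M" "j \<in> M" "i \<noteq> j" "K \<subseteq> M - {i, j}" using that by (auto simp: M_def)
        then have "(i, j, K) \<in> I" by (simp add: I_def)
        then have "gap f i j K \<noteq> 0" "gap f i j (insert a K) \<noteq> 0"
          using gap_dead[of i j K] that(5) by (auto simp: D_def)
        then show ?thesis using fM[OF ijK] by linarith
      qed
    qed
    show "\<forall>u. z u = 0"
    proof
      fix u
      show "z u = 0"
      proof (cases "u \<in> V")
        case True
        then have "u \<subseteq> M" by (simp add: V_def)
        then show ?thesis using zero[of u] \<rho>_V[OF True] by (simp add: h_def)
      qed (rule supp)
    qed
  next
    have gap_x: "gap (\<lambda>A. x (\<rho> A)) i j K = gap f i j K / f {a}" if "(i, j, K) \<in> I" for i j K
    proof -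
      have ijK: "i \<noteq> j" "K \<subseteq> M - {i, j}" using that by (auto simp: I_def)
      have "K \<subseteq> M" "insert i K \<subseteq> M" "insert j K \<subseteq> M" "insert i (insert j K) \<subseteq> M"
        using that by (auto simp: I_def)
      then have "gap (\<lambda>A. x (\<rho> A)) i j K = gap ft i j K / f {a}"
        by (simp add: gap_def x\<rho> add_divide_distrib diff_divide_distrib)
      then show ?thesis using gap_ft[OF ijK] by simp
    qed
    fix e c assume "(e, c) \<in> C"
    then consider i j K where "e = up (i, j, K)" "c = 0" "(i, j, K) \<in> I"
      | i j K where "e = dn (i, j, K)" "c = 1" "(i, j, K) \<in> D"
      using C_cases by blast
    then show "row e x + c \<ge> 0"
    proof cases
      case 1
      then have "gap f i j K \<ge> 0" by (intro fM) (auto simp: I_def)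
      then show ?thesis using 1 pos by (simp add: up gap_x)
    next
      case 2
      then have I: "(i, j, K) \<in> I" and dead: "gap f i j K = 0 \<or> gap f i j (insert a K) = 0"
        by (auto simp: D_def)
      have "gap f i j K \<le> f {a}"
        by (rule gap_le_if_dead[OF f a _ _ _ _ dead]) (use I in \<open>auto simp: I_def M_def\<close>)
      then show ?thesis using 2 pos I by (simp add: dn gap_x)
    qed
  qed
  also have "\<dots> \<le> real (vertex_bound (2 ^ m - 1 - m)) - 1"
    using vertex_bound_mono[OF card_coordinates_le[OF M(1,2) m(2)]] unfolding V_def by simp
  finally have "ft {b} / f {a} \<le> real (vertex_bound (2 ^ m - 1 - m)) - 1"
    using x\<rho>[of "{b}"] b by (simp add: M_def)
  then have "ft {b} \<le> (real (vertex_bound (2 ^ m - 1 - m)) - 1) * f {a}"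
    using pos by (simp add: pos_divide_le_eq)
  moreover have "f {b} = ft {b} + y b" by (simp add: ft_def)
  moreover have "y b \<le> f {a}" using y b by (simp add: M_def)
  ultimately show ?thesis by (simp add: algebra_simps)
qed

text \<open>
  With \<open>d = 2^m - 1 - m\<close> the bound \<open>2 d 4^d\<close> is below \<open>2^m * 2 * 4^d = 4^(2^m) / 2^(m + 1)\<close>, the
  denominator being due to the term \<open>- m\<close> in \<open>d\<close>.
\<close>

lemma vertex_bound_less:
  assumes "m \<ge> 2"
  shows "vertex_bound (2 ^ m - 1 - m) < 2 ^ 2 ^ (m + 1)"
proof -
  let ?d = "2 ^ m - 1 - m :: nat"
  have m: "m + 1 \<le> 2 ^ m" using less_exp[of m] by linarith
  have "vertex_bound ?d < 2 ^ m * (2 * 4 ^ ?d)"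
    unfolding vertex_bound_def by (intro mult_strict_right_mono) (use m in auto)
  also have "(4 :: nat) ^ ?d = 2 ^ (2 * ?d)" by (simp add: power_mult)
  also have "(2 :: nat) ^ m * (2 * 2 ^ (2 * ?d)) = 2 ^ (m + 1 + 2 * ?d)"
    by (simp add: power_add)
  also have "\<dots> \<le> 2 ^ 2 ^ (m + 1)"
    using m by (intro power_increasing) auto
  finally show ?thesis .
qed

section \<open>Reduced polymatroids with a large singleton\<close>

text \<open>
  The qualified sets of Csirmaz's access structure: the upward closure of the sets
  \<open>U j = S j \<union> {b 0, ..., b (j - 1)}\<close> with \<open>j \<le> L\<close>. The \<open>S j\<close> will be subsets of a small set \<open>A\<close> such that no
  earlier one is contained in a later one, and the \<open>b i\<close> distinct elements outside of \<open>A\<close>.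
\<close>

definition chain_qualified :: "(nat \<Rightarrow> 'a set) \<Rightarrow> (nat \<Rightarrow> 'a) \<Rightarrow> nat \<Rightarrow> 'a set \<Rightarrow> bool" where
  "chain_qualified S b L K \<longleftrightarrow> (\<exists>j\<le>L. S j \<union> b ` {..<j} \<subseteq> K)"

lemma chain_qualified_mono: "chain_qualified S b L K \<Longrightarrow> K \<subseteq> K' \<Longrightarrow> chain_qualified S b L K'"
  unfolding chain_qualified_def by blast

text \<open>
  If \<open>X\<close> and \<open>Y\<close> are qualified but \<open>X \<inter> Y\<close> is not, submodularity for \<open>aX\<close> and \<open>aY\<close> yields submodularity for \<open>X\<close>
  and \<open>Y\<close> with an excess of 1. With \<open>B i = {b 0, ..., b (i - 1)}\<close> apply this to \<open>U (i + 1)\<close> and \<open>A \<union> B i\<close>: their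
  intersection \<open>S (i + 1) \<union> B i\<close> could contain only a \<open>U j\<close> with \<open>j \<le> i\<close>, and then \<open>S j \<subseteq> S (i + 1)\<close>. So the
  conditional rank \<open>g(A \<union> B i) - g(B i)\<close> drops by at least 1 with every \<open>i\<close>, and it is still at least 1
  for \<open>i = L\<close>, as \<open>A \<union> B L\<close> is qualified and \<open>B L\<close> is not.
\<close>

lemma chain_lower_bound:
  assumes g: "polymatroid N g" and a: "a \<in> N"
    and marginal: "\<And>K. K \<subseteq> N - {a} \<Longrightarrow> g (insert a K) - g K = (if chain_qualified S b L K then 0 else 1)"
    and A: "A \<subseteq> N - {a}" and S: "\<And>j. j \<le> L \<Longrightarrow> S j \<subseteq> A" "\<And>j. j \<le> L \<Longrightarrow> S j \<noteq> {}"
    and S_chain: "\<And>i j. i < j \<Longrightarrow> j \<le> L \<Longrightarrow> \<not> S i \<subseteq> S j"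
    and b: "inj_on b {..<L}" "b ` {..<L} \<subseteq> N - {a} - A"
  shows "real (L + 1) \<le> g A"
proof -
  let ?Q = "chain_qualified S b L" and ?B = "\<lambda>i. b ` {..<i}"
  have B: "?B i \<subseteq> N - {a}" "?B i \<inter> A = {}" if "i \<le> L" for i
    using b(2) that by (auto simp: image_subset_iff)
  have jump: "g (X \<union> Y) + g (X \<inter> Y) + 1 \<le> g X + g Y"
    if "X \<subseteq> N - {a}" "Y \<subseteq> N - {a}" "?Q X" "?Q Y" "\<not> ?Q (X \<inter> Y)" for X Y
  proof -
    have "?Q (X \<union> Y)" using that(3) chain_qualified_mono by blast
    then have "g (insert a X) = g X" "g (insert a Y) = g Y" "g (insert a (X \<union> Y)) = g (X \<union> Y)"
      "g (insert a (X \<inter> Y)) = g (X \<inter> Y) + 1"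
      using marginal[of X] marginal[of Y] marginal[of "X \<union> Y"] marginal[of "X \<inter> Y"] that
      by (auto simp: le_infI1)
    moreover have "insert a X \<inter> insert a Y = insert a (X \<inter> Y)"
      "insert a X \<union> insert a Y = insert a (X \<union> Y)" "insert a X \<subseteq> N" "insert a Y \<subseteq> N"
      using that(1,2) a by auto
    ultimately show ?thesis using polymatroid_submod[OF g, of "insert a X" "insert a Y"] by simp
  qed
  have A_qualified: "?Q (A \<union> ?B i)" for i
    using S(1)[of 0] unfolding chain_qualified_def by (intro exI[of _ 0]) auto
  have step: "g (A \<union> ?B (Suc i)) - g (?B (Suc i)) + 1 \<le> g (A \<union> ?B i) - g (?B i)" if i: "i < L" for i
  proof -
    let ?X = "S (Suc i) \<union> ?B (Suc i)" and ?Y = "A \<union> ?B i" and ?Z = "S (Suc i) \<union> ?B i"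
    have SA: "S (Suc i) \<subseteq> A" using S(1) i by simp
    have bi: "b i \<notin> A" "b i \<notin> ?B i" "b i \<in> N"
    proof -
      show "b i \<notin> A" "b i \<in> N" using b(2) i by auto
      show "b i \<notin> ?B i" using b(1) i by (auto dest: inj_onD)
    qed
    have B_Suc: "?B (Suc i) = insert (b i) (?B i)" by (simp add: lessThan_Suc)
    have XY: "?X \<inter> ?Y = ?Z" "?X \<union> ?Y = A \<union> ?B (Suc i)"
      using SA bi unfolding B_Suc by auto
    have "\<not> ?Q ?Z"
    proof
      assume "?Q ?Z"
      then obtain j where j: "j \<le> L" "S j \<union> ?B j \<subseteq> ?Z" unfolding chain_qualified_def by blast
      have "\<not> i < j"
      proof
        assume "i < j"
        then have "b i \<in> ?Z" using j(2) by blast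
        then show False using bi SA by blast
      qed
      then have "S j \<subseteq> S (Suc i)" using j(2) S(1)[OF j(1)] B(2)[OF less_imp_le[OF i]] by blast
      then show False using S_chain[of j "Suc i"] \<open>\<not> i < j\<close> i by simp
    qed
    moreover have "?Q ?X" unfolding chain_qualified_def using i by (intro exI[of _ "Suc i"]) simp
    moreover have "?X \<subseteq> N - {a}" "?Y \<subseteq> N - {a}" using SA A B(1)[of "Suc i"] B(1)[of i] i by auto
    ultimately have "g (A \<union> ?B (Suc i)) + g ?Z + 1 \<le> g ?X + g ?Y"
      using jump[of ?X ?Y] A_qualified[of i] unfolding XY by blast
    \<comment> \<open>Adding b i to B i increases the rank at least as much as adding it to the larger set Z.\<close>
    moreover have "g (?B i) + g ?X \<le> g ?Z + g (?B (Suc i))"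
    proof -
      have "?Z \<inter> ?B (Suc i) = ?B i" "?Z \<union> ?B (Suc i) = ?X"
        using B(2)[of "Suc i"] SA i unfolding B_Suc by auto
      moreover have "?Z \<subseteq> N" "?B (Suc i) \<subseteq> N" using SA A B(1)[of "Suc i"] B(1)[of i] i by auto
      ultimately show ?thesis using polymatroid_submod[OF g, of ?Z "?B (Suc i)"] by simp
    qed
    ultimately show ?thesis by linarith
  qed
  have "real i + (g (A \<union> ?B i) - g (?B i)) \<le> g A" if "i \<le> L" for i
    using that
  proof (induction i)
    case 0
    show ?case using g by (simp add: polymatroid_def)
  next
    case (Suc i)
    then show ?case using step[of i] by simp
  qed
  then have "real L + (g (A \<union> ?B L) - g (?B L)) \<le> g A" by blast
  moreover have "g (?B L) + 1 \<le> g (A \<union> ?B L)"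
  proof -
    have "\<not> ?Q (?B L)"
    proof
      assume "?Q (?B L)"
      then obtain j where j: "j \<le> L" "S j \<subseteq> ?B L" unfolding chain_qualified_def by blast
      then show False using S(1)[OF j(1)] S(2)[OF j(1)] B(2)[of L] by blast
    qed
    then have "g (?B L) + 1 = g (insert a (?B L))" using marginal[of "?B L"] B(1)[of L] by simp
    also have "\<dots> \<le> g (insert a (A \<union> ?B L))"
      by (rule polymatroid_mono[OF g]) (use A B(1)[of L] a in auto)
    also have "\<dots> = g (A \<union> ?B L)"
      using marginal[of "A \<union> ?B L"] A_qualified[of L] A B(1)[of L] by simp
    finally show ?thesis .
  qed
  ultimately show ?thesis by simp
qed

text \<open>
  Add the prescribed marginals to a function of the cardinality on \<open>M\<close> that is so concave (all its gaps
  are 2) that it absorbs the failure of submodularity in the marginals. The function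
  \<open>s(j) = j (2 |N| - j)\<close> also increases by at least 1 up to \<open>j = |N| - 1\<close>, which gives monotonicity.
\<close>

lemma polymatroid_with_marginals:
  assumes fin: "finite N" and a: "a \<in> N"
    and up: "\<And>K K'. Q K \<Longrightarrow> K \<subseteq> K' \<Longrightarrow> Q K'"
  shows "\<exists>f. polymatroid N f \<and>
    (\<forall>K. K \<subseteq> N - {a} \<longrightarrow> f (insert a K) - f K = (if Q K then 0 else 1))"
proof -
  define s where "s = (\<lambda>j. real j * (2 * real (card N) - real j))"
  define u where "u = (\<lambda>A. if a \<in> A \<and> \<not> Q (A - {a}) then 1 else 0 :: real)"
  define f where "f = (\<lambda>A. s (card (A - {a})) + u A)"
  have "polymatroid N f"
  proof (rule polymatroidI[OF fin])
    show "f {} = 0" by (simp add: f_def s_def u_def)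
  next
    fix i j K assume ij: "i \<in> N" "j \<in> N" "i \<noteq> j" and K: "K \<subseteq> N - {i, j}"
    have gap_a: "gap f a j K \<ge> 0" if "j \<noteq> a" "K \<subseteq> N - {a, j}" for j K
    proof -
      have "a \<notin> K" "insert a (insert j K) - {a} = insert j K - {a}" "insert a K - {a} = K - {a}"
        "insert j K - {a} = insert j K" "K - {a} = K" using that by auto
      then show ?thesis using that(1) up[of K "insert j K"] by (auto simp: gap_def f_def u_def)
    qed
    show "gap f i j K \<ge> 0"
    proof (cases "i = a \<or> j = a")
      case True
      then show ?thesis using gap_a[of j K] gap_a[of i K] ij K gap_commute[of f i j K] by (auto simp: insert_commute)
    next
      case False
      define K' where "K' = K - {a}"
      have "finite K'" "i \<notin> K'" "j \<notin> K'" using fin K finite_subset by (auto simp: K'_def)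
      moreover have "insert i K - {a} = insert i K'" "insert j K - {a} = insert j K'"
        "insert i (insert j K) - {a} = insert i (insert j K')" using False by (auto simp: K'_def)
      ultimately have "gap f i j K = 2 * s (card K' + 1) - s (card K') - s (card K' + 2)
          + (u (insert i K) + u (insert j K) - u K - u (insert i (insert j K)))"
        using ij by (simp add: gap_def f_def flip: K'_def)
      moreover have "2 * s (c + 1) - s c - s (c + 2) = 2" for c
        by (simp add: s_def algebra_simps)
      moreover have "0 \<le> u X" "u X \<le> 1" for X by (auto simp: u_def)
      ultimately show ?thesis by (smt (verit))
    qed
  next
    fix i assume i: "i \<in> N"
    show "f (N - {i}) \<le> f N"
    proof (cases "i = a")
      case True
      then show ?thesis by (simp add: f_def u_def)
    next
      case False
      define c where "c = card (N - {a} - {i})"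
      have c: "card (N - {a}) = c + 1" "N - {i} - {a} = N - {a} - {i}"
        using card.remove[of "N - {a}" i] i False fin by (auto simp: c_def)
      have "card N = c + 2" using card.remove[OF fin a] c(1) by simp
      then have "s (c + 1) - s c \<ge> 1" by (simp add: s_def algebra_simps)
      moreover have "u (N - {i}) \<le> u N + 1" by (simp add: u_def)
      ultimately show ?thesis by (simp add: f_def c flip: c_def)
    qed
  qed
  moreover have "f (insert a K) - f K = (if Q K then 0 else 1)" if "K \<subseteq> N - {a}" for K
  proof -
    have "a \<notin> K" using that by auto
    then show ?thesis by (simp add: f_def u_def)
  qed
  ultimately show ?thesis by blast
qed

lemma polymatroid_le_sum_singletons:
  assumes f: "polymatroid N f" and "finite A" "A \<subseteq> N"
  shows "f A \<le> (\<Sum>x\<in>A. f {x})"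
  using assms(2,3)
proof (induction A rule: finite_induct)
  case empty
  then show ?case using f by (simp add: polymatroid_def)
next
  case (insert x A)
  have "f ({x} \<inter> A) + f ({x} \<union> A) \<le> f {x} + f A"
    by (rule polymatroid_submod[OF f]) (use insert in auto)
  then show ?case using insert f by (simp add: polymatroid_def)
qed

text \<open>
  Sorting the nonempty subsets by decreasing cardinality ensures that no earlier one is contained in
  a later one.
\<close>

lemma subsets_in_nonincreasing_order:
  assumes "finite A"
  shows "\<exists>S :: nat \<Rightarrow> 'a set. (\<forall>j < 2 ^ card A - 1. S j \<subseteq> A \<and> S j \<noteq> {}) \<and>
    (\<forall>i j. i < j \<and> j < 2 ^ card A - 1 \<longrightarrow> \<not> S i \<subseteq> S j)"
proof -
  obtain ys where ys: "set ys = Pow A - {{}}" "distinct ys"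
    using finite_distinct_list[of "Pow A - {{}}"] assms by auto
  define xs where "xs = sort_key (\<lambda>S. card A - card S) ys"
  have xs: "set xs = Pow A - {{}}" "distinct xs" "length xs = length ys"
    using ys by (auto simp: xs_def)
  have len: "length xs = 2 ^ card A - 1"
    using distinct_card[OF xs(2)] assms by (simp add: xs(1) card_Pow)
  have nth: "xs ! j \<subseteq> A" "xs ! j \<noteq> {}" if "j < length xs" for j
    using nth_mem[OF that] unfolding xs(1) by auto
  have "\<not> xs ! i \<subseteq> xs ! j" if ij: "i < j" "j < length xs" for i j
  proof
    assume sub: "xs ! i \<subseteq> xs ! j"
    have "sorted (map (\<lambda>S. card A - card S) xs)" by (simp add: xs_def)
    from sorted_nth_mono[OF this, of i j] ij
    have "card A - card (xs ! i) \<le> card A - card (xs ! j)" by simp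
    moreover have "card (xs ! i) \<le> card A" "card (xs ! j) \<le> card A"
      using nth(1)[of i] nth(1)[of j] ij assms by (simp_all add: card_mono)
    ultimately have "card (xs ! j) \<le> card (xs ! i)" by linarith
    moreover have "finite (xs ! j)" using nth(1)[OF ij(2)] assms finite_subset by blast
    ultimately have "xs ! i = xs ! j" using sub by (simp add: card_seteq)
    then show False using xs(2) ij by (simp add: nth_eq_iff_index_eq)
  qed
  then show ?thesis using nth unfolding len by (intro exI[of _ "\<lambda>j. xs ! j"]) auto
qed

text \<open>
  The elements of \<open>N\<close> other than \<open>a\<close>, the \<open>k\<close> elements of \<open>A\<close> and the \<open>L\<close> elements \<open>b i\<close> do not occur in
  the sets generating the qualified family, so every \<open>n \<ge> L + k + 1\<close> is covered.
\<close>

theorem exists_reduced_with_large_singleton: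
  assumes fin: "finite N" and a: "a \<in> N" and n: "card N = n"
    and k: "L + 1 < 2 ^ k" "L + k + 1 \<le> n"
  shows "\<exists>g. reduced_polymatroid N a g \<and> g {a} = 1 \<and> (\<exists>x\<in>N. (real L + 1) / real k \<le> g {x})"
proof -
  have "k \<le> card (N - {a})" using fin a n k by simp
  then obtain A where A: "A \<subseteq> N - {a}" "card A = k" "finite A"
    by (rule obtain_subset_with_card_n)
  have "card (N - {a} - A) = n - 1 - k" using fin a n A by (simp add: card_Diff_subset)
  then have "L \<le> card (N - {a} - A)" using k by simp
  then have initial: "{..<L} \<subseteq> {0..<card (N - {a} - A)}" by auto
  obtain b where bij: "bij_betw b {0..<card (N - {a} - A)} (N - {a} - A)"
    using ex_bij_betw_nat_finite[of "N - {a} - A"] fin by blast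
  note inj = bij_betw_imp_inj_on[OF bij] and img = bij_betw_imp_surj_on[OF bij]
  have b: "inj_on b {..<L}" "b ` {..<L} \<subseteq> N - {a} - A"
    using inj_on_subset[OF inj initial] image_mono[OF initial, of b] unfolding img .
  obtain S :: "nat \<Rightarrow> 'a set" where S: "\<forall>j < 2 ^ k - 1. S j \<subseteq> A \<and> S j \<noteq> {}"
    "\<forall>i j. i < j \<and> j < 2 ^ k - 1 \<longrightarrow> \<not> S i \<subseteq> S j"
    using subsets_in_nonincreasing_order[OF A(3)] unfolding A(2)
    by (elim exE conjE) (rule that)
  have less: "j < 2 ^ k - 1" if "j \<le> L" for j using that k(1) by linarith
  obtain f where f: "polymatroid N f"
    "\<And>K. K \<subseteq> N - {a} \<Longrightarrow> f (insert a K) - f K = (if chain_qualified S b L K then 0 else 1)"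
    using polymatroid_with_marginals[OF fin a, of "chain_qualified S b L"] chain_qualified_mono by blast
  obtain g where g: "reduced_polymatroid N a g"
    "\<And>K. K \<subseteq> N - {a} \<Longrightarrow> g (insert a K) - g K = f (insert a K) - f K"
    using exists_reduced_part[OF fin f(1), of a] by blast
  have poly: "polymatroid N g" using g(1) by (simp add: reduced_polymatroid_def)
  have "real (L + 1) \<le> g A"
  proof (rule chain_lower_bound[OF poly a _ A(1) _ _ _ b])
    show "g (insert a K) - g K = (if chain_qualified S b L K then 0 else 1)" if "K \<subseteq> N - {a}" for K
      using f(2)[OF that] g(2)[OF that] by simp
    show "S j \<subseteq> A" "S j \<noteq> {}" if "j \<le> L" for j using S(1) less[OF that] by blast+
    show "\<not> S i \<subseteq> S j" if "i < j" "j \<le> L" for i j using S(2) that(1) less[OF that(2)] by blast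
  qed
  also have "\<dots> \<le> (\<Sum>x\<in>A. g {x})"
    by (rule polymatroid_le_sum_singletons[OF poly A(3)]) (use A in auto)
  finally have sum: "real (L + 1) \<le> (\<Sum>x\<in>A. g {x})" .
  have "k \<noteq> 0"
  proof
    assume "k = 0"
    then show False using k(1) by simp
  qed
  have "\<exists>x\<in>A. (real L + 1) / real k \<le> g {x}"
  proof (rule ccontr)
    assume "\<not> ?thesis"
    then have "(\<Sum>x\<in>A. g {x}) < (\<Sum>x\<in>A. (real L + 1) / real k)"
      using A \<open>k \<noteq> 0\<close> by (intro sum_strict_mono) auto
    then show False using sum A \<open>k \<noteq> 0\<close> by simp
  qed
  moreover have "g {a} = 1"
  proof -
    have "\<not> chain_qualified S b L {}" using S(1) less unfolding chain_qualified_def by blast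
    then show ?thesis using f(2)[of "{}"] g(2)[of "{}"] poly by (simp add: polymatroid_def)
  qed
  ultimately show ?thesis using g(1) A(1) by blast
qed

section \<open>The bounds on the supremum\<close>

lemma log2_ge_chord:
  assumes "1 \<le> x" "x \<le> 2"
  shows "x - 1 \<le> log 2 x"
proof -
  have c: "concave_on {0<..} (log 2)" by (rule log_concave) simp
  have "(1 - (x - 1)) * log 2 1 + (x - 1) * log 2 2 \<le> log 2 ((1 - (x - 1)) *\<^sub>R 1 + (x - 1) *\<^sub>R 2)"
    by (rule concave_onD[OF c]) (use assms in auto)
  then show ?thesis by (simp add: algebra_simps)
qed

text \<open>
  Here \<open>l\<close> is the length of the chain available for \<open>k = \<lfloor>log\<^sub>2 n\<rfloor>\<close>. If it is limited by the number \<open>n - k\<close> of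
  remaining elements, then \<open>k \<le> log\<^sub>2 n\<close> and \<open>2 k \<le> n\<close> suffice. If it is limited by the number \<open>2^k - 1\<close> of
  nonempty sets, then with \<open>Q = 2^k\<close> one has \<open>(Q - 1) / k \<ge> Q / (k + 1)\<close>, and \<open>Q / (k + 1)\<close> is the value of
  \<open>n / (2 log\<^sub>2 n)\<close> at \<open>n = 2 Q\<close>. That smaller \<open>n \<ge> Q\<close> do not give more is seen by replacing \<open>log\<^sub>2 n\<close> by
  its chord \<open>\<Lambda>\<close> between \<open>Q\<close> and \<open>2 Q\<close>.
\<close>

lemma chain_length_ratio:
  assumes k: "2 ^ k \<le> n" "n < 2 ^ (k + 1)" and n: "n \<ge> 2" and l: "l = min (2 ^ k - 1) (n - k)"
  shows "real n / (2 * log 2 (real n)) \<le> real l / real k"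
proof -
  have k1: "k \<ge> 1"
  proof (rule ccontr)
    assume "\<not> k \<ge> 1"
    then have "k = 0" by simp
    then show False using k n by simp
  qed
  have q: "k + 1 \<le> 2 ^ k" using less_exp[of k] by linarith
  have kn: "2 * k \<le> 2 ^ k" using k1
  proof (induction k rule: dec_induct)
    case (step j)
    have "(2::nat) \<le> 2 ^ j" using step.hyps(1) self_le_power[of 2 j] by simp
    then show ?case using step.IH by simp
  qed simp
  define Q where "Q = (2::real) ^ k"
  have Q: "Q \<ge> real k + 1" "Q > 0" "Q \<le> real n" "real n \<le> 2 * Q"
  proof -
    show "Q \<ge> real k + 1" using q unfolding Q_def by (metis of_nat_1 of_nat_add of_nat_le_iff of_nat_numeral of_nat_power)
    show "Q > 0" by (simp add: Q_def)
    show "Q \<le> real n" using k(1) unfolding Q_def by (metis of_nat_le_iff of_nat_numeral of_nat_power)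
    have "real n < real (2 ^ (k + 1))" using k(2) of_nat_less_iff by blast
    then show "real n \<le> 2 * Q" by (simp add: Q_def)
  qed
  define \<Lambda> where "\<Lambda> = real k + (real n / Q - 1)"
  have \<Lambda>: "\<Lambda> \<le> log 2 (real n)"
  proof -
    have "real n / Q - 1 \<le> log 2 (real n / Q)"
      by (rule log2_ge_chord) (use Q in \<open>auto simp: field_simps\<close>)
    also have "\<dots> = log 2 (real n) - real k"
      using n by (simp add: log_divide_pos Q_def log_nat_power)
    finally show ?thesis by (simp add: \<Lambda>_def)
  qed
  have \<Lambda>k: "\<Lambda> \<ge> real k" using Q by (simp add: \<Lambda>_def field_simps)
  then have pos: "\<Lambda> > 0" using k1 by linarith
  have "real n / (2 * log 2 (real n)) \<le> real n / (2 * \<Lambda>)"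
    using \<Lambda> pos by (intro divide_left_mono) auto
  also have "\<dots> \<le> real l / real k"
  proof (cases "n - k \<le> 2 ^ k - 1")
    case True
    then have "l = n - k" using l by simp
    have "real n / (2 * \<Lambda>) \<le> real n / (2 * real k)"
      using \<Lambda>k k1 pos by (intro divide_left_mono) auto
    also have "\<dots> \<le> real (n - k) / real k"
    proof -
      have "real n \<le> 2 * real (n - k)" using kn k(1) by linarith
      then show ?thesis using k1 by (simp add: field_simps)
    qed
    finally show ?thesis unfolding \<open>l = n - k\<close> .
  next
    case False
    then have "real l = Q - 1" using l q by (simp add: Q_def)
    have 1: "(real k + 1) * real n \<le> 2 * (Q * \<Lambda>)"
    proof -
      have "Q * \<Lambda> = Q * (real k - 1) + real n" using Q by (simp add: \<Lambda>_def algebra_simps)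
      moreover have "(real k - 1) * real n \<le> (real k - 1) * (2 * Q)"
        using k1 Q(4) by (intro mult_left_mono) auto
      ultimately show ?thesis by (simp add: algebra_simps)
    qed
    have 2: "Q * real k \<le> (real k + 1) * (Q - 1)" using Q(1) by (simp add: algebra_simps)
    have "(real k + 1) * (real n * real k) \<le> 2 * (Q * \<Lambda>) * real k"
      using mult_right_mono[OF 1, of "real k"] by (simp add: algebra_simps)
    also have "\<dots> = 2 * \<Lambda> * (Q * real k)" by simp
    also have "\<dots> \<le> 2 * \<Lambda> * ((real k + 1) * (Q - 1))"
      using 2 pos by (intro mult_left_mono) auto
    also have "\<dots> = (real k + 1) * ((Q - 1) * (2 * \<Lambda>))" by (simp add: algebra_simps)
    finally have "real n * real k \<le> (Q - 1) * (2 * \<Lambda>)" by simp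
    then show ?thesis
      using pos k1 unfolding \<open>real l = Q - 1\<close> by (simp add: divide_le_eq le_divide_eq pos_le_divide_eq pos_divide_le_eq)
  qed
  finally show ?thesis .
qed

theorem theorem1:
  fixes N :: "'a set" and a :: 'a and n :: nat
  assumes "finite N" and "card N = n" and "n \<ge> 2" and "a \<in> N"
  shows "ereal (real n / (2 * log 2 (real n))) \<le> reduced_sup N a \<and>
         reduced_sup N a < ereal (2 ^ (2 ^ n))"
proof
  note fin = assms(1) and a = assms(4)
  obtain k where k: "2 ^ k \<le> n" "n < 2 ^ (k + 1)"
    using ex_power_ivl1[of 2 n] assms(3) by auto
  define L where "L = min (2 ^ k - 1) (n - k) - 1"
  have "k \<ge> 1"
  proof (rule ccontr)
    assume "\<not> k \<ge> 1"
    then have "k = 0" by simp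
    then show False using k assms(3) by simp
  qed
  then have "(2::nat) \<le> 2 ^ k" using self_le_power[of 2 k] by simp
  moreover have "k < n" using k(1) less_exp[of k] by linarith
  ultimately have L: "L + 1 = min (2 ^ k - 1) (n - k)" by (simp add: L_def)
  have "L + 1 < 2 ^ k" "L + k + 1 \<le> n"
    using L \<open>k < n\<close> \<open>2 \<le> 2 ^ k\<close> by linarith+
  then obtain g x where g: "reduced_polymatroid N a g" "g {a} = 1" and x: "x \<in> N" "(real L + 1) / real k \<le> g {x}"
    using exists_reduced_with_large_singleton[OF fin a assms(2)] by blast
  have "real n / (2 * log 2 (real n)) \<le> real (L + 1) / real k"
    by (rule chain_length_ratio[OF k assms(3) L])
  also have "\<dots> \<le> g {x} / g {a}" using x g(2) by (simp add: add.commute)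
  also have "\<dots> \<le> singleton_ratio N a g"
    unfolding singleton_ratio_def using fin x(1) by (intro Max_ge) auto
  finally have "ereal (real n / (2 * log 2 (real n))) \<le> ereal (singleton_ratio N a g)" by simp
  also have "\<dots> \<le> reduced_sup N a"
    unfolding reduced_sup_def by (rule SUP_upper) (use g in auto)
  finally show "ereal (real n / (2 * log 2 (real n))) \<le> reduced_sup N a" .

  define m where "m = n - 1"
  have m: "card (N - {a}) = m" "n = m + 1" using assms by (auto simp: m_def)
  define W where "W = (if m \<ge> 2 then max 1 (real (vertex_bound (2 ^ m - 1 - m))) else 1)"
  have "f {b} / f {a} \<le> W" if red: "reduced_polymatroid N a f" and pos: "f {a} > 0" and b: "b \<in> N" for f b
  proof (cases "b = a")
    case True
    then show ?thesis using pos by (simp add: W_def)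
  next
    case False
    show ?thesis
    proof (cases "m \<ge> 2")
      case True
      then have "f {b} \<le> real (vertex_bound (2 ^ m - 1 - m)) * f {a}"
        using reduced_singleton_bound[OF fin a red pos _ m(1)] b False by simp
      then have "f {b} / f {a} \<le> real (vertex_bound (2 ^ m - 1 - m))"
        using pos by (simp add: pos_divide_le_eq)
      then show ?thesis using True by (simp add: W_def)
    next
      case False2: False
      \<comment> \<open>For \<open>n = 2\<close>, tightness alone bounds the ratio by 1.\<close>
      then have "card (N - {a}) = 1" using m assms(3) by simp
      moreover have "b \<in> N - {a}" using b False by simp
      ultimately have "N - {a} = {b}" by (metis card_1_singletonE singletonD)
      then have "N - {b} = {a}" using a False by auto
      then have "f {a} = f N"
        using reduced_tight[OF fin a red, of b] \<open>b \<in> N - {a}\<close> by simp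
      moreover have "f {b} \<le> f N"
        using red b polymatroid_mono[of N f "{b}" N] by (simp add: reduced_polymatroid_def)
      ultimately show ?thesis using pos False2 by (simp add: W_def)
    qed
  qed
  then have "singleton_ratio N a f \<le> W" if "reduced_polymatroid N a f" "f {a} > 0" for f
    unfolding singleton_ratio_def using fin a that by (subst Max_le_iff) auto
  then have "reduced_sup N a \<le> ereal W"
    unfolding reduced_sup_def by (intro SUP_least) auto
  also have "W < 2 ^ 2 ^ n"
  proof -
    have "1 < (2::real) ^ 2 ^ n" by (rule one_less_power) auto
    moreover have "real (vertex_bound (2 ^ m - 1 - m)) < 2 ^ 2 ^ n" if "m \<ge> 2"
    proof -
      have "real (vertex_bound (2 ^ m - 1 - m)) < real (2 ^ 2 ^ n)"
        using vertex_bound_less[OF that] unfolding m(2) of_nat_less_iff .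
      then show ?thesis by simp
    qed
    ultimately show ?thesis by (simp add: W_def)
  qed
  finally show "reduced_sup N a < ereal (2 ^ 2 ^ n)" by simp
qed

end
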